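(* Let $E=\{0,1,\infty,z_0,\dots,z_n\}$ be a finite subset of $\widehat{\mathbb{C}}$ consisting of $n+4$ distinct points $(n\ge 0)$. (1) There exist a Riemann surface $X$ and a normalized holomorphic motion $\phi:X\times E\to\widehat{\mathbb{C}}$ such that $n(\alpha;z,z')=0$ for any closed curve $\alpha$ in $X$ and for any distinct points $z,z'$ in $E\setminus\{\infty\}$, but $\phi$ cannot be extended to a holomorphic motion of $\widehat{\mathbb{C}}$ over $X$. (2) There exist a Riemann surface $X$ and a normalized holomorphic motion $\phi:X\times E\to\widehat{\mathbb{C}}$ such that for any proper subset $E'$ of $E$, the restriction $\phi|E'$ of $\phi$ to $X\times E'$ can be extended to a holomorphic motion of $\widehat{\mathbb{C}}$ over $X$, but $\phi$ cannot be extended to a holomorphic motion of $\widehat{\mathbb{C}}$ over $X$.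
   Context: Let $X$ be a (connected) Riemann surface with basepoint $p_0$ and $E\subset\widehat{\mathbb{C}}$. A map $\phi:X\times E\to\widehat{\mathbb{C}}$ is a holomorphic motion of $E$ over $X$ if (i) $\phi(p_0,z)=z$ for all $z\in E$; (ii) for each $p\in X$, $\phi(p,\cdot)$ is injective on $E$; (iii) for each $z\in E$, $\phi(\cdot,z)$ is holomorphic on $X$. It is normalized if $0,1,\infty\in E$ and $\phi(p,\cdot)$ fixes $0,1,\infty$ for every $p\in X$. A holomorphic motion $\widehat\phi$ of $\widehat{\mathbb{C}}$ over $X$ (same basepoint) extends $\phi$ if $\widehat\phi=\phi$ on $X\times E$. For distinct $z,z'\in E\setminus\{\infty\}$ and a (smooth) closed curve $\alpha$ in $X$, $$n(\alpha;z,z')=\int_\alpha d\arg\bigl(\phi(\cdot,z)-\phi(\cdot,z')\bigr)\in 2\pi\mathbb{Z}$$ is the variation of the argument of $\phi(\cdot,z)-\phi(\cdot,z')$ along $\alpha$. *)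

theory Defs
  imports "HOL-Complex_Analysis.Complex_Analysis"
begin

section \<open>Riemann surfaces and holomorphic maps\<close>

text \<open>
  A surface is a topology together with an atlas. A chart is a pair of a domain and a
  coordinate function; the values of the coordinate function off its domain are irrelevant.
\<close>

record 'a surface =
  surface_top :: "'a topology"
  atlas :: "('a set \<times> ('a \<Rightarrow> complex)) set"

abbreviation points :: "'a surface \<Rightarrow> 'a set" where
  "points X \<equiv> topspace (surface_top X)"

definition complex_chart :: "'a topology \<Rightarrow> 'a set \<Rightarrow> ('a \<Rightarrow> complex) \<Rightarrow> bool" where
  "complex_chart T U f \<longleftrightarrow>
     openin T U \<and> open (f ` U) \<and>
     homeomorphic_map (subtopology T U) (top_of_set (f ` U)) f"

text \<open>
  As usual, Riemann surfaces are connected. Second countability need not be required: by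
  Rado's theorem it is automatic. In particular a Riemann surface has the cardinality of
  the continuum, so up to isomorphism every Riemann surface has type
  \<^typ>\<open>complex surface\<close>.
\<close>

definition riemann_surface :: "'a surface \<Rightarrow> bool" where
  "riemann_surface X \<longleftrightarrow>
     points X \<noteq> {} \<and> connected_space (surface_top X) \<and> Hausdorff_space (surface_top X) \<and>
     (\<forall>(U, f) \<in> atlas X. complex_chart (surface_top X) U f) \<and>
     (\<Union>(U, f) \<in> atlas X. U) = points X \<and>
     (\<forall>(U, f) \<in> atlas X. \<forall>(V, g) \<in> atlas X.
        (g \<circ> inv_into U f) holomorphic_on f ` (U \<inter> V))"

definition holomorphic_map :: "'a surface \<Rightarrow> 'b surface \<Rightarrow> ('a \<Rightarrow> 'b) \<Rightarrow> bool" where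
  "holomorphic_map X Y h \<longleftrightarrow>
     continuous_map (surface_top X) (surface_top Y) h \<and>
     (\<forall>(U, f) \<in> atlas X. \<forall>(V, g) \<in> atlas Y.
        (g \<circ> h \<circ> inv_into U f) holomorphic_on f ` {p \<in> U. h p \<in> V})"


section \<open>The Riemann sphere\<close>

text \<open>
  The point at infinity is \<^term>\<open>None\<close>. The two charts are the identity on the finite
  points and \<open>z \<mapsto> 1 / z\<close> on the nonzero points.
\<close>

type_synonym riemann_sphere = "complex option"

definition sphere_inversion :: "riemann_sphere \<Rightarrow> complex" where
  "sphere_inversion x = (case x of None \<Rightarrow> 0 | Some z \<Rightarrow> inverse z)"

definition sphere :: "riemann_sphere surface" where
  "sphere =
     \<lparr>surface_top = Alexandroff_compactification euclidean,
      atlas = {(range Some, the), (- {Some 0}, sphere_inversion)}\<rparr>"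

lemma points_sphere [simp]: "points sphere = UNIV"
  by (auto simp: sphere_def) (metis option.exhaust rangeI)

abbreviation sphere_top :: "riemann_sphere topology" where
  "sphere_top \<equiv> Alexandroff_compactification euclidean"

lemma complex_chartI:
  assumes "openin T U" "openin T U \<Longrightarrow> f ` U = S" "open S"
    and "continuous_map (subtopology T U) (top_of_set S) f"
    and "continuous_map (top_of_set S) T g"
    and "\<And>x. x \<in> U \<Longrightarrow> g (f x) = x" "\<And>z. z \<in> S \<Longrightarrow> g z \<in> U \<and> f (g z) = z"
  shows "complex_chart T U f"
proof -
  have "U \<subseteq> topspace T"
    using assms(1) openin_subset by blast
  then have "homeomorphic_maps (subtopology T U) (top_of_set S) f g"
    using assms by (auto simp: homeomorphic_maps_def continuous_map_in_subtopology)
  then show ?thesis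
    using assms by (auto simp: complex_chart_def dest: homeomorphic_maps_imp_map)
qed

lemma complex_chart_sphere_the: "complex_chart sphere_top (range Some) the"
proof (rule complex_chartI[where S = UNIV and g = Some])
  show "continuous_map (subtopology sphere_top (range Some)) (top_of_set UNIV) the"
    unfolding continuous_map_def
  proof (intro conjI allI impI)
    fix U :: "complex set"
    assume "openin (top_of_set UNIV) U"
    then have "openin sphere_top (Some ` U)"
      by simp
    moreover have "{x \<in> topspace (subtopology sphere_top (range Some)). the x \<in> U} = Some ` U"
      by auto
    ultimately show "openin (subtopology sphere_top (range Some))
        {x \<in> topspace (subtopology sphere_top (range Some)). the x \<in> U}"
      unfolding openin_subtopology by (intro exI[of _ "Some ` U"]) auto
  qed auto
  show "continuous_map (top_of_set UNIV) sphere_top (Some :: complex \<Rightarrow> _)"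
    by (simp add: continuous_map_Some)
qed (auto simp: openin_Alexandroff_compactification image_image intro!: image_eqI)

lemma closed_inverse_vimage:
  fixes C :: "complex set"
  assumes "compact C"
  shows "closed {z. z \<noteq> 0 \<and> inverse z \<in> C}"
proof -
  have "inverse z \<in> C \<longleftrightarrow> z \<in> inverse ` C" for z :: complex
    by (metis image_iff inverse_inverse_eq)
  obtain B where B: "B > 0" "\<And>z. z \<in> C \<Longrightarrow> norm z \<le> B"
    using assms bounded_pos compact_imp_bounded by metis
  have *: "{z. z \<noteq> 0 \<and> inverse z \<in> C} = {z \<in> - ball 0 (inverse B). inverse z \<in> C}"
  proof (intro set_eqI iffI)
    fix z
    assume z: "z \<in> {z. z \<noteq> 0 \<and> inverse z \<in> C}"
    then have "inverse (norm z) \<le> B" "norm z > 0"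
      using B(2)[of "inverse z"] by (auto simp: norm_inverse)
    then have "inverse B \<le> norm z"
      by (metis B(1) inverse_inverse_eq le_imp_inverse_le positive_imp_inverse_positive)
    then show "z \<in> {z \<in> - ball 0 (inverse B). inverse z \<in> C}"
      using z by auto
  qed (use B in auto)
  have "continuous_on (- ball 0 (inverse B)) (inverse :: complex \<Rightarrow> complex)"
    using B(1) by (intro continuous_intros) auto
  then have "closed {z \<in> - ball 0 (inverse B). inverse z \<in> C}"
    using continuous_closed_preimage[of "- ball 0 (inverse B)" inverse C] assms
    by (simp add: compact_imp_closed closed_Compl vimage_def Int_def)
  then show ?thesis
    by (simp add: *)
qed

lemma open_inverse_vimage:
  fixes U :: "complex set"
  assumes "open U"
  shows "open {z. z \<noteq> 0 \<and> inverse z \<in> U}"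
proof -
  have "continuous_on (- {0}) (inverse :: complex \<Rightarrow> complex)"
    by (intro continuous_intros) auto
  then have "open (- {0} \<inter> inverse -` U)"
    using assms by (intro continuous_open_preimage) auto
  then show ?thesis
    by (auto simp: vimage_def Int_def)
qed

lemma complex_chart_sphere_inversion:
  "complex_chart sphere_top (- {Some 0}) sphere_inversion"
proof (rule complex_chartI[where S = UNIV and
        g = "\<lambda>z. if z = 0 then None else Some (inverse z)"])
  have *: "insert None (Some ` (- {0})) = - {Some (0 :: complex)}"
    by (force simp: image_iff split: option.split)
  show opn: "openin sphere_top (- {Some 0})"
    unfolding openin_Alexandroff_compactification *[symmetric]
    by (intro disjI2 exI[of _ "{0}"]) (auto simp: Compl_eq_Diff_UNIV)
  show "continuous_map (subtopology sphere_top (- {Some 0})) (top_of_set UNIV) sphere_inversion"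
    unfolding continuous_map_def
  proof (intro conjI allI impI)
    fix U :: "complex set"
    assume "openin (top_of_set UNIV) U"
    then have U: "open U"
      by simp
    have "openin sphere_top {x. x \<noteq> Some 0 \<and> sphere_inversion x \<in> U}"
    proof (cases "0 \<in> U")
      case False
      have "{x. x \<noteq> Some 0 \<and> sphere_inversion x \<in> U} = Some ` {z. z \<noteq> 0 \<and> inverse z \<in> U}"
        using False by (auto simp: sphere_inversion_def split: option.splits)
      then show ?thesis
        using open_inverse_vimage[OF U] by simp
    next
      case True
      define C where "C = - {z. z \<noteq> 0 \<and> inverse z \<in> U}"
      obtain e where e: "e > 0" "ball 0 e \<subseteq> U"
        using U True open_contains_ball by blast
      have "norm z \<le> inverse e" if "z \<in> C" for z
      proof (rule ccontr)
        assume "\<not> norm z \<le> inverse e"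
        then have nz: "norm z > inverse e"
          by simp
        then have "norm z > 0"
          using e(1) by (meson less_trans positive_imp_inverse_positive)
        moreover have "inverse (norm z) < e"
          using nz e(1) by (metis inverse_inverse_eq less_imp_inverse_less
              positive_imp_inverse_positive)
        ultimately have "z \<noteq> 0" "inverse z \<in> ball 0 e"
          by (auto simp: norm_inverse)
        then show False
          using that e(2) by (auto simp: C_def)
      qed
      then have "bounded C"
        by (auto simp: bounded_iff)
      moreover have "closed C"
        unfolding C_def using open_inverse_vimage[OF U] by (simp add: closed_Compl)
      ultimately have "compact C"
        by (simp add: compact_eq_bounded_closed)
      moreover have "{x. x \<noteq> Some 0 \<and> sphere_inversion x \<in> U} = insert None (Some ` (UNIV - C))"
      proof (rule set_eqI)
        show "x \<in> {x. x \<noteq> Some 0 \<and> sphere_inversion x \<in> U} \<longleftrightarrow>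
            x \<in> insert None (Some ` (UNIV - C))" for x
          using True by (cases x) (auto simp: sphere_inversion_def C_def)
      qed
      ultimately show ?thesis
        by (auto simp: openin_Alexandroff_compactification compact_imp_closed)
    qed
    moreover have "{x \<in> topspace (subtopology sphere_top (- {Some 0})). sphere_inversion x \<in> U}
        = {x. x \<noteq> Some 0 \<and> sphere_inversion x \<in> U}"
      using points_sphere by (auto simp: sphere_def)
    ultimately show "openin (subtopology sphere_top (- {Some 0}))
        {x \<in> topspace (subtopology sphere_top (- {Some 0})). sphere_inversion x \<in> U}"
      using opn by (auto simp: openin_open_subtopology)
  qed auto
  show "continuous_map (top_of_set UNIV) sphere_top
      (\<lambda>z. if z = 0 then None else Some (inverse z))" (is "continuous_map _ _ ?g")
    unfolding continuous_map_def
  proof (intro conjI allI impI)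
    fix V :: "riemann_sphere set"
    assume "openin sphere_top V"
    then consider U where "open U" "V = Some ` U" |
      C where "compact C" "V = insert None (Some ` (UNIV - C))"
      by (auto simp: openin_Alexandroff_compactification)
    then have "open {z. ?g z \<in> V}"
    proof cases
      case 1
      then have "{z. ?g z \<in> V} = {z. z \<noteq> 0 \<and> inverse z \<in> U}"
        by auto
      then show ?thesis
        using 1 open_inverse_vimage by simp
    next
      case 2
      then have "{z. ?g z \<in> V} = - {z. z \<noteq> 0 \<and> inverse z \<in> C}"
        by auto
      then show ?thesis
        using 2 closed_inverse_vimage by (simp add: open_Compl)
    qed
    then show "openin (top_of_set UNIV) {z \<in> topspace (top_of_set UNIV). ?g z \<in> V}"
      by simp
  qed auto
  have "z \<in> sphere_inversion ` (- {Some 0})" for z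
    by (rule image_eqI[of _ _ "if z = 0 then None else Some (inverse z)"])
       (auto simp: sphere_inversion_def)
  then show "sphere_inversion ` (- {Some 0}) = UNIV"
    by blast
qed (auto simp: sphere_inversion_def split: option.splits if_splits)

lemma riemann_surface_sphere: "riemann_surface sphere"
proof -
  have inv_the: "inv_into (range Some) the z = Some z" for z :: complex
    by (rule inv_into_f_eq) (auto intro: inj_onI)
  have inj: "inj_on sphere_inversion (- {Some 0})"
    by (rule inj_onI) (auto simp: sphere_inversion_def split: option.splits)
  have inv_inversion: "inv_into (- {Some 0}) sphere_inversion z = Some (inverse z)"
    if "z \<noteq> 0" for z
    by (rule inv_into_f_eq[OF inj]) (use that in \<open>auto simp: sphere_inversion_def\<close>)
  have inv_inversion_0: "inv_into (- {Some 0}) sphere_inversion 0 = None"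
    by (rule inv_into_f_eq[OF inj]) (auto simp: sphere_inversion_def)
  have overlap: "the ` (range Some \<inter> - {Some 0}) \<subseteq> - {0 :: complex}"
    "sphere_inversion ` (- {Some 0} \<inter> range Some) \<subseteq> - {0}"
    by (auto simp: sphere_inversion_def)
  have hol: "inverse holomorphic_on (- {0 :: complex})"
    by (intro holomorphic_intros) auto
  have "(the \<circ> inv_into (range Some) the) holomorphic_on A" for A
    by (rule holomorphic_transform[OF holomorphic_on_ident]) (simp add: inv_the)
  moreover have "(sphere_inversion \<circ> inv_into (range Some) the) holomorphic_on
      the ` (range Some \<inter> - {Some 0})"
    by (rule holomorphic_transform[OF holomorphic_on_subset[OF hol overlap(1)]])
       (simp add: inv_the sphere_inversion_def)
  moreover have "(the \<circ> inv_into (- {Some 0}) sphere_inversion) holomorphic_on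
      sphere_inversion ` (- {Some 0} \<inter> range Some)"
  proof (rule holomorphic_transform[OF holomorphic_on_subset[OF hol overlap(2)]])
    fix z
    assume "z \<in> sphere_inversion ` (- {Some 0} \<inter> range Some)"
    then have "z \<noteq> 0"
      using overlap(2) by blast
    then show "inverse z = (the \<circ> inv_into (- {Some 0}) sphere_inversion) z"
      by (simp add: inv_inversion)
  qed
  moreover have "(sphere_inversion \<circ> inv_into (- {Some 0}) sphere_inversion) holomorphic_on A" for A
  proof (rule holomorphic_transform[OF holomorphic_on_ident])
    show "z = (sphere_inversion \<circ> inv_into (- {Some 0}) sphere_inversion) z" for z
      by (cases "z = 0") (simp_all add: inv_inversion inv_inversion_0, simp_all add: sphere_inversion_def)
  qed
  moreover have "connected_space sphere_top"
  proof -
    have "connectedin sphere_top (Some ` topspace (euclidean :: complex topology))"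
      using connectedin_continuous_map_image[OF continuous_map_Some, of euclidean "UNIV :: complex set"]
        connected_UNIV by simp
    moreover have "\<not> compact_space (euclidean :: complex topology)"
      by (simp add: compact_space_def)
    ultimately show ?thesis
      using connectedin_closure_of Alexandroff_compactification_dense connectedin_topspace
      by metis
  qed
  moreover have "Hausdorff_space sphere_top"
    by (simp add: Hausdorff_space_Alexandroff_compactification locally_compact_space_euclidean)
  moreover have "range Some \<union> - {Some 0} = (UNIV :: riemann_sphere set)"
    by auto
  moreover have "topspace sphere_top = UNIV"
    using points_sphere by (simp add: sphere_def)
  ultimately show ?thesis
    using complex_chart_sphere_the complex_chart_sphere_inversion
    by (simp add: riemann_surface_def sphere_def)
qed


section \<open>Holomorphic motions\<close>

definition holomorphic_motion ::
  "'a surface \<Rightarrow> 'a \<Rightarrow> riemann_sphere set \<Rightarrow> ('a \<Rightarrow> riemann_sphere \<Rightarrow> riemann_sphere) \<Rightarrow> bool"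
where
  "holomorphic_motion X p\<^sub>0 E \<phi> \<longleftrightarrow>
     p\<^sub>0 \<in> points X \<and>
     (\<forall>z\<in>E. \<phi> p\<^sub>0 z = z) \<and>
     (\<forall>p\<in>points X. inj_on (\<phi> p) E) \<and>
     (\<forall>z\<in>E. holomorphic_map X sphere (\<lambda>p. \<phi> p z))"

definition normalized_motion ::
  "'a surface \<Rightarrow> riemann_sphere set \<Rightarrow> ('a \<Rightarrow> riemann_sphere \<Rightarrow> riemann_sphere) \<Rightarrow> bool"
where
  "normalized_motion X E \<phi> \<longleftrightarrow>
     {Some 0, Some 1, None} \<subseteq> E \<and>
     (\<forall>p\<in>points X. \<forall>z\<in>{Some 0, Some 1, None}. \<phi> p z = z)"

text \<open>The restriction of a motion to a subset \<open>E'\<close> is the same function used with \<open>E'\<close>.\<close>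

definition extends_to_sphere ::
  "'a surface \<Rightarrow> 'a \<Rightarrow> riemann_sphere set \<Rightarrow> ('a \<Rightarrow> riemann_sphere \<Rightarrow> riemann_sphere) \<Rightarrow> bool"
where
  "extends_to_sphere X p\<^sub>0 E \<phi> \<longleftrightarrow>
     (\<exists>\<psi>. holomorphic_motion X p\<^sub>0 UNIV \<psi> \<and> (\<forall>p\<in>points X. \<forall>z\<in>E. \<psi> p z = \<phi> p z))"


section \<open>Variation of the argument along closed curves\<close>

text \<open>
  Piecewise smoothness is tested in charts, on the parameter intervals that the
  curve maps into the domain of the chart.
\<close>

definition closed_curve :: "'a surface \<Rightarrow> (real \<Rightarrow> 'a) \<Rightarrow> bool" where
  "closed_curve X \<alpha> \<longleftrightarrow>
     pathin (surface_top X) \<alpha> \<and> \<alpha> 0 = \<alpha> 1 \<and>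
     (\<forall>(U, f) \<in> atlas X. \<forall>a b. 0 \<le> a \<and> a \<le> b \<and> b \<le> 1 \<and> \<alpha> ` {a..b} \<subseteq> U \<longrightarrow>
        (f \<circ> \<alpha>) piecewise_C1_differentiable_on {a..b})"

text \<open>
  For a nowhere vanishing \<open>F\<close>, the form \<open>d arg F\<close> is the imaginary part of
  \<open>dF / F\<close>, the pullback of \<open>dw / w\<close> under \<open>F\<close>. For \<open>z \<noteq> z'\<close> in \<open>E - {\<infinity>}\<close>, the values
  of a normalized motion of \<open>E\<close> at \<open>z\<close> and \<open>z'\<close> are finite and distinct,
  so that \<^const>\<open>the\<close> is applied to finite points only and the integrand has no pole.
\<close>

definition arg_variation ::
  "('a \<Rightarrow> riemann_sphere \<Rightarrow> riemann_sphere) \<Rightarrow> (real \<Rightarrow> 'a) \<Rightarrow>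
     riemann_sphere \<Rightarrow> riemann_sphere \<Rightarrow> real"
where
  "arg_variation \<phi> \<alpha> z z' =
     Im (contour_integral (\<lambda>t. the (\<phi> (\<alpha> t) z) - the (\<phi> (\<alpha> t) z')) (\<lambda>w. 1 / w))"

end

theory Submission
  imports Defs
begin

text \<open>
  Only one point \<open>\<zeta>\<close> of \<open>E\<close> moves; the other finite points form a set \<open>A\<close> of punctures. It
  moves along a loop \<open>f\<close> that is Brunnian: not null-homotopic in the complement of \<open>A\<close>, but
  null-homotopic as soon as any one puncture (or \<open>\<infinity>\<close>) is filled in. Such a loop is an
  iterated commutator of loops around the punctures, and it can be taken to be holomorphic on a
  thin annulus \<open>X\<close> around the unit circle.

  A motion of the whole sphere extending this one would make the loops traced out by all points off
  \<open>A\<close> freely homotopic, and points near the puncture \<open>0\<close> trace out null-homotopic loops;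
  so there is no extension. Conversely, a null-homotopy of \<open>f\<close> yields a motion of the whole
  plane over \<open>X\<close>: it is cut into small steps, each of which pushes a small disc by a Lipschitz
  perturbation of the preceding maps, averaged by a partition of unity that is holomorphic in the
  parameter. One and the same motion therefore serves for both parts.
\<close>

section \<open>Null-homotopic loops and commutators\<close>

text \<open>A commutator is contractible exactly when its factors commute, so of the structure of
  the fundamental group only one fact is needed: a loop of winding number 0 about \<open>a\<close>
  that commutes with one of winding number 1 about \<open>a\<close> is contractible. The logarithm
  at \<open>a\<close> turns commuting into invariance under a translation. Infinity has no winding
  number of its own; it is treated as the puncture 0 after an inversion. The circle supplies
  flexibility: continuous functions on it are uniform limits of functions holomorphic off 0, so
  homotopies and partitions of unity have holomorphic substitutes. The price is that the lower
  Lipschitz bound is proved over the circle only. Thinning the annulus must then preserve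
  injectivity for all \<open>z\<close> in an unbounded plane at once, hence estimates relative to
  \<open>norm (z - w)\<close>. A motion is not assumed to be continuous in \<open>z\<close>. That
  neighbouring points trace homotopic loops comes from Schottky's theorem, since quotients of traced
  functions omit two values. The argument variation about a puncture \<open>b\<close> vanishes
  because some extension still fixes \<open>b\<close> after another puncture has been filled in; 0
  and 1 guarantee that there is another one.\<close>

definition null_loop :: "'a::topological_space set \<Rightarrow> (real \<Rightarrow> 'a) \<Rightarrow> bool" where
  "null_loop S x \<longleftrightarrow> homotopic_paths S x (\<lambda>_. pathstart x)"

text \<open>Grouped as (xy)(yx)^-1 rather than as a product of four loops, so that contractibility
  is literally a homotopy between \<open>x +++ y\<close> and \<open>y +++ x\<close>.\<close>

definition comm_loop :: "(real \<Rightarrow> 'a) \<Rightarrow> (real \<Rightarrow> 'a) \<Rightarrow> real \<Rightarrow> 'a::topological_space" where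
  "comm_loop x y = (x +++ y) +++ reversepath (y +++ x)"

lemma linepath_refl_const: "linepath a a = (\<lambda>_. a)"
  by (auto simp: linepath_def algebra_simps)

lemma null_loopD:
  assumes "null_loop S x"
  shows "path x" "path_image x \<subseteq> S" "pathfinish x = pathstart x"
proof -
  have *: "homotopic_paths S x (\<lambda>_. pathstart x)"
    using assms by (simp add: null_loop_def)
  show "path x" "path_image x \<subseteq> S" "pathfinish x = pathstart x"
    using homotopic_paths_imp_path[OF *] homotopic_paths_imp_subset[OF *]
      homotopic_paths_imp_pathfinish[OF *] by (simp_all add: pathfinish_def)
qed

text \<open>A free contraction can be conjugated into a based one. Contractibility is therefore
  invariant under free homotopy, and base points need not be tracked.\<close>

lemma null_loop_iff_loops:
  fixes x :: "real \<Rightarrow> 'a::real_normed_vector"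
  shows "null_loop S x \<longleftrightarrow> (\<exists>a. homotopic_loops S x (\<lambda>_. a))"
proof
  assume *: "null_loop S x"
  then have "homotopic_paths S x (\<lambda>_. pathstart x)"
    by (simp add: null_loop_def)
  then have "homotopic_loops S x (\<lambda>_. pathstart x)"
    by (rule homotopic_paths_imp_homotopic_loops) (use null_loopD[OF *] in \<open>auto simp: pathfinish_def\<close>)
  then show "\<exists>a. homotopic_loops S x (\<lambda>_. a)" ..
next
  assume "\<exists>a. homotopic_loops S x (\<lambda>_. a)"
  then show "null_loop S x"
    using homotopic_loops_imp_homotopic_paths_null[of S x]
    unfolding null_loop_def linepath_refl_const by blast
qed

lemma null_loop_homotopic:
  fixes x :: "real \<Rightarrow> 'a::real_normed_vector"
  assumes "null_loop S x" "homotopic_loops S x y"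
  shows "null_loop S y"
proof -
  obtain a where "homotopic_loops S x (\<lambda>_. a)"
    using assms(1) unfolding null_loop_iff_loops by blast
  then have "homotopic_loops S y (\<lambda>_. a)"
    by (rule homotopic_loops_trans[OF homotopic_loops_sym[OF assms(2)]])
  then show ?thesis
    unfolding null_loop_iff_loops by blast
qed

lemma null_loop_image:
  assumes "null_loop S x" "continuous_on S h" "h ` S \<subseteq> T"
  shows "null_loop T (h \<circ> x)"
proof -
  have "homotopic_paths T (h \<circ> x) (h \<circ> (\<lambda>_. pathstart x))"
    using assms unfolding null_loop_def by (intro homotopic_paths_continuous_image) auto
  then show ?thesis
    by (simp add: null_loop_def pathstart_def o_def)
qed

lemma null_loop_convex:
  fixes S :: "'a::real_normed_vector set"
  assumes "path x" "pathfinish x = pathstart x" "path_image x \<subseteq> C" "convex C" "C \<subseteq> S"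
  shows "null_loop S x"
proof -
  have "homotopic_loops S x (linepath (pathstart x) (pathstart x))"
  proof (rule homotopic_loops_linear)
    fix t :: real
    assume "t \<in> {0..1}"
    then have "x t \<in> C" "pathstart x \<in> C"
      using assms(3) pathstart_in_path_image[of x] by (auto simp: path_image_def)
    then show "closed_segment (x t) (linepath (pathstart x) (pathstart x) t) \<subseteq> S"
      using assms(4,5) closed_segment_subset[of "x t" C "pathstart x"]
      by (auto simp: linepath_refl_const)
  qed (use assms in auto)
  then show ?thesis
    unfolding null_loop_iff_loops linepath_refl_const by blast
qed

lemma null_comm_loop_iff:
  fixes x :: "real \<Rightarrow> 'a::real_normed_vector"
  assumes "path x" "path y" "pathfinish x = pathstart x" "pathstart y = pathstart x"
    "pathfinish y = pathstart x"
  shows "null_loop S (comm_loop x y) \<longleftrightarrow> homotopic_paths S (x +++ y) (y +++ x)"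
proof
  assume "null_loop S (comm_loop x y)"
  then obtain a where "homotopic_loops S (comm_loop x y) (linepath a a)"
    unfolding null_loop_iff_loops linepath_refl_const by blast
  then show "homotopic_paths S (x +++ y) (y +++ x)"
    unfolding comm_loop_def using assms by (intro homotopic_paths_loop_parts) auto
next
  assume *: "homotopic_paths S (x +++ y) (y +++ x)"
  have yx: "path (y +++ x)" "path_image (y +++ x) \<subseteq> S"
    using homotopic_paths_imp_path[OF *] homotopic_paths_imp_subset[OF *] by auto
  have "homotopic_paths S (comm_loop x y) ((y +++ x) +++ reversepath (y +++ x))"
    unfolding comm_loop_def
    by (rule homotopic_paths_join[OF *]) (use yx assms in auto)
  also have "homotopic_paths S \<dots> (linepath (pathstart x) (pathstart x))"
    using homotopic_paths_rinv[OF yx] assms by simp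
  finally show "null_loop S (comm_loop x y)"
    by (simp add: null_loop_def linepath_refl_const comm_loop_def)
qed

text \<open>As soon as one factor contracts, both products reduce to the other factor. This is how
  filling in a puncture kills each commutator that involves a loop around it.\<close>

lemma null_comm_loop:
  fixes x :: "real \<Rightarrow> 'a::real_normed_vector"
  assumes "path x" "path y" "pathfinish x = pathstart x" "pathstart y = pathstart x"
    "pathfinish y = pathstart x" "path_image x \<subseteq> S" "path_image y \<subseteq> S"
    and "null_loop S x \<or> null_loop S y"
  shows "null_loop S (comm_loop x y)"
proof -
  have *: "homotopic_paths S (x +++ y) y \<and> homotopic_paths S (y +++ x) y"
    if "path x" "path y" "pathfinish x = pathstart x" "pathstart y = pathstart x"
      "pathfinish y = pathstart x" "path_image x \<subseteq> S" "path_image y \<subseteq> S" "null_loop S x"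
    for x y :: "real \<Rightarrow> 'a"
  proof -
    have 1: "homotopic_paths S x (linepath (pathstart x) (pathstart x))"
      using that by (simp add: null_loop_def linepath_refl_const)
    have "homotopic_paths S (x +++ y) (linepath (pathstart y) (pathstart y) +++ y)"
      using 1 that by (intro homotopic_paths_join) auto
    also have "homotopic_paths S \<dots> y"
      using that by (intro homotopic_paths_lid) auto
    finally have 2: "homotopic_paths S (x +++ y) y" .
    have "homotopic_paths S (y +++ x) (y +++ linepath (pathfinish y) (pathfinish y))"
      using 1 that by (intro homotopic_paths_join) auto
    also have "homotopic_paths S \<dots> y"
      using that by (intro homotopic_paths_rid) auto
    finally show ?thesis
      using 2 by blast
  qed
  have "homotopic_paths S (x +++ y) (y +++ x)"
  proof (cases "null_loop S x")
    case True
    then have "homotopic_paths S (x +++ y) y" and y: "homotopic_paths S (y +++ x) y"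
      using *[OF assms(1-7)] by auto
    from this(1) homotopic_paths_sym[OF y] show ?thesis
      by (rule homotopic_paths_trans)
  next
    case False
    then have y: "null_loop S y"
      using assms(8) by blast
    have "homotopic_paths S (y +++ x) x \<and> homotopic_paths S (x +++ y) x"
      by (rule *[OF assms(2,1) _ _ _ assms(7,6) y]) (simp_all add: assms(3-5))
    then have "homotopic_paths S (x +++ y) x" and x: "homotopic_paths S (y +++ x) x"
      by auto
    from this(1) homotopic_paths_sym[OF x] show ?thesis
      by (rule homotopic_paths_trans)
  qed
  then show ?thesis
    using null_comm_loop_iff[OF assms(1-5)] by blast
qed

lemma comm_loop_compose: "f \<circ> comm_loop x y = comm_loop (f \<circ> x) (f \<circ> y)"
  by (auto simp: comm_loop_def path_compose_join path_compose_reversepath)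

lemma comm_loop_path [simp]:
  assumes "path x" "path y" "pathfinish x = pathstart x" "pathstart y = pathstart x"
    "pathfinish y = pathstart x"
  shows "path (comm_loop x y)" "pathstart (comm_loop x y) = pathstart x"
    "pathfinish (comm_loop x y) = pathstart x"
    "path_image (comm_loop x y) = path_image x \<union> path_image y"
  using assms by (auto simp: comm_loop_def path_image_join)

section \<open>Coverings of multiply punctured planes and periodic sets of punctures\<close>

lemma covering_space_restrict:
  fixes p :: "'a::real_normed_vector \<Rightarrow> 'b::real_normed_vector"
  assumes cov: "covering_space C p S" and "T \<subseteq> S"
  shows "covering_space (C \<inter> p -` T) p T"
  unfolding covering_space_def
proof (intro conjI ballI)
  show "continuous_on (C \<inter> p -` T) p"
    using cov by (auto simp: covering_space_def intro: continuous_on_subset)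
  show "p ` (C \<inter> p -` T) = T"
    using cov assms(2) by (auto simp: covering_space_def)
  fix x
  assume "x \<in> T"
  then obtain W V where W: "x \<in> W" "openin (top_of_set S) W"
    and V: "\<Union>V = C \<inter> p -` W" "\<forall>u\<in>V. openin (top_of_set C) u" "pairwise disjnt V"
      "\<forall>u\<in>V. \<exists>q. homeomorphism u W p q"
    using cov subsetD[OF assms(2) \<open>x \<in> T\<close>] unfolding covering_space_def by meson
  define V' where "V' = (\<lambda>u. u \<inter> p -` T) ` V"
  show "\<exists>W. x \<in> W \<and> openin (top_of_set T) W \<and>
      (\<exists>v. \<Union>v = C \<inter> p -` T \<inter> p -` W \<and>
         (\<forall>u\<in>v. openin (top_of_set (C \<inter> p -` T)) u) \<and> pairwise disjnt v \<and>
         (\<forall>u\<in>v. \<exists>q. homeomorphism u W p q))"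
  proof (intro exI[of _ "W \<inter> T"] exI[of _ V'] conjI ballI)
    show "x \<in> W \<inter> T"
      using \<open>x \<in> T\<close> W by auto
    show "openin (top_of_set T) (W \<inter> T)"
      using W(2) assms(2) by (auto simp: openin_open)
    show "\<Union> V' = C \<inter> p -` T \<inter> p -` (W \<inter> T)"
      using V(1) by (auto simp: V'_def)
    show "pairwise disjnt V'"
      using V(3) by (auto simp: V'_def pairwise_def disjnt_def)
    fix u'
    assume "u' \<in> V'"
    then obtain u where u: "u \<in> V" "u' = u \<inter> p -` T"
      by (auto simp: V'_def)
    show "openin (top_of_set (C \<inter> p -` T)) u'"
      using V(2) u by (fastforce simp: openin_open)
    obtain q where q: "homeomorphism u W p q"
      using V(4) u by blast
    have "homeomorphism u' (W \<inter> T) p q"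
      by (rule homeomorphism_of_subsets[OF q])
         (use q u in \<open>auto simp: homeomorphism_def\<close>)
    then show "\<exists>q. homeomorphism u' (W \<inter> T) p q" by blast
  qed
qed

lemma countable_exp_vimage:
  fixes A :: "complex set"
  assumes "countable A"
  shows "countable (exp -` A)"
proof -
  have "exp -` A \<subseteq> (\<Union>c\<in>A. \<Union>n::int. {Ln c + complex_of_real (real_of_int (2 * n) * pi) * \<i>})"
  proof
    fix u :: complex
    assume u: "u \<in> exp -` A"
    have "exp u = exp (Ln (exp u))"
      by simp
    then obtain n :: int where "u = Ln (exp u) + complex_of_real (real_of_int (2 * n) * pi) * \<i>"
      using exp_eq[of u "Ln (exp u)"] by blast
    then show "u \<in> (\<Union>c\<in>A. \<Union>n::int. {Ln c + complex_of_real (real_of_int (2 * n) * pi) * \<i>})"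
      using u by blast
  qed
  moreover have "countable \<dots>"
    using assms by auto
  ultimately show ?thesis
    using countable_subset by blast
qed

lemma homotopic_loops_translates:
  fixes v :: "'a::real_normed_vector"
  assumes "homotopic_loops S x (\<lambda>t. x t + v)" and S: "\<And>u. u \<in> S \<Longrightarrow> u + v \<in> S"
  shows "homotopic_loops S x (\<lambda>t. x t + real k *\<^sub>R v)"
proof (induction k)
  case 0
  have "homotopic_loops S x x"
    by (rule homotopic_loops_trans[OF assms(1) homotopic_loops_sym[OF assms(1)]])
  then show ?case
    by simp
next
  case (Suc k)
  have "homotopic_loops S ((\<lambda>u. u + v) \<circ> x) ((\<lambda>u. u + v) \<circ> (\<lambda>t. x t + real k *\<^sub>R v))"
    by (rule homotopic_loops_continuous_image[OF Suc]) (use S in \<open>auto intro!: continuous_intros\<close>)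
  then have "homotopic_loops S (\<lambda>t. x t + v) (\<lambda>t. x t + real (Suc k) *\<^sub>R v)"
    by (simp add: o_def algebra_simps)
  then show ?case
    using assms(1) homotopic_loops_trans by blast
qed

section \<open>Commuting loops\<close>

lemma homotopic_paths_exp_lift:
  fixes S :: "complex set"
  assumes "0 \<notin> S" "homotopic_paths S g1 g2" "path h1" "path h2" "pathstart h1 = pathstart h2"
    and "\<And>t. t \<in> {0..1} \<Longrightarrow> exp (h1 t) = g1 t" "\<And>t. t \<in> {0..1} \<Longrightarrow> exp (h2 t) = g2 t"
  shows "homotopic_paths (exp -` S) h1 h2"
proof -
  have "S \<subseteq> - {0}"
    using assms(1) by auto
  then have cov: "covering_space (UNIV \<inter> exp -` S) exp S"
    by (rule covering_space_restrict[OF covering_space_exp_punctured_plane])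
  have g: "path g1" "path g2" "path_image g1 \<subseteq> S" "path_image g2 \<subseteq> S"
    using homotopic_paths_imp_path[OF assms(2)] homotopic_paths_imp_subset[OF assms(2)] by auto
  then have h: "path_image h1 \<subseteq> UNIV \<inter> exp -` S" "path_image h2 \<subseteq> UNIV \<inter> exp -` S"
    using assms(6,7) by (auto simp: path_image_def)
  show ?thesis
    using covering_space_lift_homotopic_paths[OF cov g(1,3,2,4) assms(2) assms(3) h(1) assms(6)
        assms(4) h(2) assms(7) assms(5)] by simp
qed

lemma log_lift:
  assumes "path x" "0 \<notin> path_image x" "exp u = pathstart x"
  obtains h where "path h" "pathstart h = u" "\<And>t. t \<in> {0..1} \<Longrightarrow> exp (h t) = x t"
    "pathfinish h = u + 2 * of_real pi * \<i> * winding_number x 0"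
proof -
  obtain h where h: "path h" "pathstart h = u" "\<And>t. t \<in> {0..1} \<Longrightarrow> exp (h t) = x t"
    using covering_space_lift_path_strong[OF covering_space_exp_punctured_plane, of u x] assms
    by auto
  have "winding_number x 0 = winding_number (exp \<circ> h) 0"
    by (rule winding_number_cong) (use h in auto)
  also have "\<dots> = (pathfinish h - u) / (2 * of_real pi * \<i>)"
    using winding_number_compose_exp[OF h(1)] h(2) by simp
  finally have "pathfinish h = u + 2 * of_real pi * \<i> * winding_number x 0"
    by (simp add: field_simps)
  then show ?thesis
    using that h by blast
qed

text \<open>The hypothesis makes \<open>x\<close> homotopic to y x' y^-1, and conjugation is a free
  homotopy. The base points of \<open>x\<close> and \<open>x'\<close> may differ, as they do for a
  lift and its translate.\<close>

lemma homotopic_loops_commute: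
  fixes x :: "real \<Rightarrow> 'a::real_normed_vector"
  assumes "homotopic_paths S (x +++ y) (y +++ x')" "path x" "path y" "path x'"
    "pathfinish x = pathstart x" "pathstart y = pathstart x" "pathfinish y = pathstart x'"
    "pathfinish x' = pathstart x'"
  shows "homotopic_loops S x x'"
proof -
  have im: "path_image x \<subseteq> S" "path_image y \<subseteq> S" "path_image x' \<subseteq> S"
    using homotopic_paths_imp_subset[OF assms(1)] assms by (auto simp: path_image_join)
  have "homotopic_paths S x (x +++ linepath (pathfinish x) (pathfinish x))"
    using homotopic_paths_rid[OF assms(2) im(1)] homotopic_paths_sym by blast
  also have "homotopic_paths S \<dots> (x +++ (y +++ reversepath y))"
    using homotopic_paths_sym[OF homotopic_paths_rinv[OF assms(3) im(2)]] assms im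
    by (intro homotopic_paths_join) auto
  also have "homotopic_paths S \<dots> ((x +++ y) +++ reversepath y)"
    using assms im by (intro homotopic_paths_assoc) auto
  also have "homotopic_paths S \<dots> ((y +++ x') +++ reversepath y)"
    by (rule homotopic_paths_join[OF assms(1)]) (use assms im in auto)
  also have "homotopic_paths S \<dots> (y +++ (x' +++ reversepath y))"
    using assms im by (intro homotopic_paths_sym[OF homotopic_paths_assoc]) auto
  finally have "homotopic_loops S x (y +++ (x' +++ reversepath y))"
    by (rule homotopic_paths_imp_homotopic_loops) (use assms in auto)
  moreover have "homotopic_loops S (y +++ (x' +++ reversepath y)) x'"
    using assms im by (intro homotopic_loops_conjugate) auto
  ultimately show ?thesis
    by (rule homotopic_loops_trans)
qed

text \<open>Translates of \<open>x\<close> far up contract if only the part of \<open>B\<close> below a generic height \<open>M\<close>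
  is removed; hence so does \<open>x\<close>, and flattening the plane onto \<open>Im u \<le> M\<close> pushes this
  contraction off the rest of \<open>B\<close>.\<close>

lemma null_loop_of_translate:
  fixes B :: "complex set"
  assumes B: "countable B" and hom: "homotopic_loops (- B) x (\<lambda>t. x t + 2 * of_real pi * \<i>)"
    and per: "\<And>u. u \<in> B \<longleftrightarrow> u + 2 * of_real pi * \<i> \<in> B"
  shows "null_loop (- B) x"
proof -
  have x: "path x" "pathfinish x = pathstart x" "path_image x \<subseteq> - B"
    using homotopic_loops_imp_path[OF hom] homotopic_loops_imp_loop[OF hom]
      homotopic_loops_imp_subset[OF hom] by auto
  obtain b where b: "\<And>t. t \<in> {0..1} \<Longrightarrow> norm (x t) \<le> b"
    using bounded_path_image[OF x(1)] unfolding bounded_iff path_image_def by blast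
  \<comment> \<open>The points of \<open>B\<close> have only countably many heights, so some height
    just above the loop is free.\<close>
  have "\<not> {b<..<b + 1} \<subseteq> Im ` B"
    using uncountable_open_interval[of b "b + 1"] countable_subset[of "{b<..<b + 1}" "Im ` B"] B
    by auto
  then obtain M where "M \<in> {b<..<b + 1}" and "M \<notin> Im ` B"
    by blast
  then have M: "b < M" "M \<notin> Im ` B"
    by auto
  \<comment> \<open>Translating by \<open>2 * pi * k \<ge> k\<close> lifts the loop, whose height is
    at least \<open>- b\<close>, above \<open>M\<close>.\<close>
  obtain k :: nat where k: "M + b < real k"
    using reals_Archimedean2 by blast
  define low where "low = {u \<in> B. Im u < M}"
  have Im_x: "\<bar>Im (x t)\<bar> \<le> b" if "t \<in> {0..1}" for t
    using b[OF that] abs_Im_le_cmod[of "x t"] by linarith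
  have "homotopic_loops (- B) x (\<lambda>t. x t + real k *\<^sub>R (2 * of_real pi * \<i>))"
    by (rule homotopic_loops_translates[OF hom]) (use per in auto)
  then have 1: "homotopic_loops (- low) (\<lambda>t. x t + real k *\<^sub>R (2 * of_real pi * \<i>)) x"
    by (rule homotopic_loops_sym[OF homotopic_loops_subset]) (auto simp: low_def)
  have "null_loop (- low) (\<lambda>t. x t + real k *\<^sub>R (2 * of_real pi * \<i>))"
  proof (rule null_loop_convex)
    show "path (\<lambda>t. x t + real k *\<^sub>R (2 * of_real pi * \<i>))"
      using x(1) unfolding path_def by (intro continuous_intros)
    show "convex {u. Im u \<ge> M}"
      by (rule convex_halfspace_Im_ge)
    show "path_image (\<lambda>t. x t + real k *\<^sub>R (2 * of_real pi * \<i>)) \<subseteq> {u. Im u \<ge> M}"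
    proof (clarsimp simp: path_image_def)
      fix t :: real
      assume "0 \<le> t" "t \<le> 1"
      then have "- b \<le> Im (x t)"
        using Im_x[of t] by auto
      moreover have "real k * 1 \<le> real k * (2 * pi)"
        using pi_gt3 by (intro mult_left_mono) auto
      ultimately show "M \<le> Im (x t) + real k * (2 * pi)"
        using k by linarith
    qed
  qed (use x in \<open>auto simp: low_def pathstart_def pathfinish_def\<close>)
  then have "null_loop (- low) x"
    by (rule null_loop_homotopic[OF _ 1])
  then have "null_loop (- B) ((\<lambda>u. Complex (Re u) (min (Im u) M)) \<circ> x)"
  proof (rule null_loop_image)
    show "continuous_on (- low) (\<lambda>u. Complex (Re u) (min (Im u) M))"
      unfolding Complex_eq by (intro continuous_intros)
    show "(\<lambda>u. Complex (Re u) (min (Im u) M)) ` (- low) \<subseteq> - B"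
    proof clarsimp
      fix u
      assume u: "u \<notin> low" "Complex (Re u) (min (Im u) M) \<in> B"
      then have "Im u < M"
        using M(2) by (force simp: min_def image_iff split: if_splits)
      then show False
        using u by (simp add: low_def)
    qed
  qed
  moreover have "homotopic_loops (- B) ((\<lambda>u. Complex (Re u) (min (Im u) M)) \<circ> x) x"
  proof (rule homotopic_loops_eq)
    show "path ((\<lambda>u. Complex (Re u) (min (Im u) M)) \<circ> x)"
      using calculation null_loopD(1) by blast
    show "path_image ((\<lambda>u. Complex (Re u) (min (Im u) M)) \<circ> x) \<subseteq> - B"
      using calculation null_loopD(2) by blast
    show "pathfinish ((\<lambda>u. Complex (Re u) (min (Im u) M)) \<circ> x) =
      pathstart ((\<lambda>u. Complex (Re u) (min (Im u) M)) \<circ> x)"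
      using calculation null_loopD(3) by blast
    fix t :: real
    assume "t \<in> {0..1}"
    then have "Im (x t) \<le> M"
      using Im_x[of t] M(1) by linarith
    then show "((\<lambda>u. Complex (Re u) (min (Im u) M)) \<circ> x) t = x t"
      by (simp add: min_def complex_eq_iff)
  qed
  ultimately show ?thesis
    by (rule null_loop_homotopic)
qed

text \<open>In the logarithmic coordinate \<open>y\<close> becomes a path from \<open>u\<close> to \<open>u + 2 \<pi> i\<close>, so that
  commuting with \<open>y\<close> means being homotopic to a translate.\<close>

lemma commuting_loop_null_0:
  fixes A :: "complex set"
  assumes A: "countable A" "0 \<in> A"
    and hom: "homotopic_paths (- A) (x +++ y) (y +++ x)"
    and xy: "path x" "path y" "pathfinish x = pathstart x" "pathstart y = pathstart x"
      "pathfinish y = pathstart x"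
    and wn: "winding_number x 0 = 0" "winding_number y 0 = 1"
  shows "null_loop (- A) x"
proof -
  have im: "path_image x \<subseteq> - A" "path_image y \<subseteq> - A"
    using homotopic_paths_imp_subset[OF hom] xy by (auto simp: path_image_join)
  have "pathstart x \<noteq> 0"
    using im(1) A(2) pathstart_in_path_image[of x] by auto
  then obtain u where u: "exp u = pathstart x"
    using exp_Ln by blast
  obtain X where X: "path X" "pathstart X = u" "\<And>t. t \<in> {0..1} \<Longrightarrow> exp (X t) = x t"
    "pathfinish X = u"
    using log_lift[of x u] xy(1) im(1) A(2) u wn(1) by auto
  obtain Y where Y: "path Y" "pathstart Y = u" "\<And>t. t \<in> {0..1} \<Longrightarrow> exp (Y t) = y t"
    "pathfinish Y = u + 2 * of_real pi * \<i>"
    using log_lift[of y u] xy im(2) A(2) u wn(2) by auto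
  \<comment> \<open>Since \<open>x\<close> has winding number 0 its lift closes up, and the lift
    that starts where \<open>Y\<close> ends is the translate by one period.\<close>
  define X' where "X' = (\<lambda>t. X t + 2 * of_real pi * \<i>)"
  have X': "path X'" "pathstart X' = u + 2 * of_real pi * \<i>" "pathfinish X' = u + 2 * of_real pi * \<i>"
    "\<And>t. t \<in> {0..1} \<Longrightarrow> exp (X' t) = x t"
    using X by (auto simp: X'_def path_def pathstart_def pathfinish_def exp_add
        intro!: continuous_intros)
  define B where "B = exp -` A"
  have "homotopic_paths (exp -` (- A)) (X +++ Y) (Y +++ X')"
  proof (rule homotopic_paths_exp_lift[OF _ hom])
    fix t :: real
    assume "t \<in> {0..1}"
    then show "exp ((X +++ Y) t) = (x +++ y) t" "exp ((Y +++ X') t) = (y +++ x) t"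
      using X(3) Y(3) X'(4) by (auto simp: joinpaths_def)
  qed (use A(2) X Y X' in auto)
  then have "homotopic_loops (exp -` (- A)) X X'"
    using X Y X' by (intro homotopic_loops_commute[where y = Y]) auto
  then have "homotopic_loops (- B) X (\<lambda>t. X t + 2 * of_real pi * \<i>)"
    by (simp add: B_def vimage_Compl X'_def)
  then have "null_loop (- B) X"
    by (rule null_loop_of_translate[rotated])
       (auto simp: B_def exp_add countable_exp_vimage[OF A(1)])
  then have "null_loop (- A) (exp \<circ> X)"
    by (rule null_loop_image) (auto simp: B_def intro!: continuous_intros)
  moreover have "homotopic_loops (- A) (exp \<circ> X) x"
    by (rule homotopic_loops_eq)
       (use calculation null_loopD[of "- A" "exp \<circ> X"] X(3) in auto)
  ultimately show ?thesis
    by (rule null_loop_homotopic)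
qed

lemma commuting_loop_null:
  fixes A :: "complex set"
  assumes A: "countable A" "a \<in> A"
    and hom: "homotopic_paths (- A) (x +++ y) (y +++ x)"
    and xy: "path x" "path y" "pathfinish x = pathstart x" "pathstart y = pathstart x"
      "pathfinish y = pathstart x"
    and wn: "winding_number x a = 0" "winding_number y a = 1"
  shows "null_loop (- A) x"
proof -
  define s where "s = (\<lambda>z. z - a)"
  define A' where "A' = s ` A"
  have sA: "s ` (- A) \<subseteq> - A'"
    by (auto simp: A'_def s_def)
  have "homotopic_paths (- A') (s \<circ> (x +++ y)) (s \<circ> (y +++ x))"
    by (rule homotopic_paths_continuous_image[OF hom])
       (use sA in \<open>auto simp: s_def intro!: continuous_intros\<close>)
  then have *: "homotopic_paths (- A') ((s \<circ> x) +++ (s \<circ> y)) ((s \<circ> y) +++ (s \<circ> x))"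
    by (simp add: path_compose_join)
  have "null_loop (- A') (s \<circ> x)"
  proof (rule commuting_loop_null_0[OF _ _ *])
    show "winding_number (s \<circ> x) 0 = 0" "winding_number (s \<circ> y) 0 = 1"
      using wn winding_number_offset[of x a] winding_number_offset[of y a]
      by (simp_all add: s_def o_def)
    show "path (s \<circ> x)" "path (s \<circ> y)"
      using xy by (auto simp: s_def path_def o_def intro!: continuous_intros)
  qed (use A xy in \<open>auto simp: A'_def s_def pathstart_def pathfinish_def image_iff\<close>)
  then have "null_loop (- A) ((\<lambda>z. z + a) \<circ> (s \<circ> x))"
    by (rule null_loop_image) (auto simp: A'_def s_def image_iff intro!: continuous_intros, metis add_diff_cancel_right')
  then show ?thesis
    by (simp add: s_def o_def)
qed

section \<open>Brunnian loops\<close>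

lemma null_loop_winding_number:
  assumes "null_loop S x" "a \<notin> S"
  shows "winding_number x a = 0"
proof -
  have "homotopic_paths (- {a}) x (\<lambda>_. pathstart x)"
    using assms unfolding null_loop_def by (auto intro: homotopic_paths_subset)
  then have "winding_number x a = winding_number (\<lambda>_. pathstart x) a"
    by (rule winding_number_homotopic_paths)
  moreover have "pathstart x \<noteq> a"
    using null_loopD(2)[OF assms(1)] assms(2) pathstart_in_path_image[of x] by auto
  ultimately show ?thesis
    by (simp add: winding_number_zero_const)
qed

text \<open>A lasso: run to a small circle around \<open>a\<close>, once around it, and back. The
  disc bounded by the circle meets \<open>A\<close> in \<open>a\<close> alone, so the lasso
  contracts once \<open>a\<close> is filled in.\<close>

lemma puncture_loop:
  fixes A :: "complex set"
  assumes "finite A" "a \<in> A" "\<zeta> \<notin> A"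
  obtains y where "path y" "pathstart y = \<zeta>" "pathfinish y = \<zeta>" "path_image y \<subseteq> - A"
    "winding_number y a = 1" "null_loop (- (A - {a})) y"
proof -
  obtain d where d: "d > 0" "\<And>x. x \<in> A \<Longrightarrow> x \<noteq> a \<Longrightarrow> d \<le> dist a x"
    using finite_set_avoid[OF assms(1)] by metis
  define c where "c = circlepath a (d / 2)"
  have c: "path c" "pathstart c = a + of_real (d / 2)" "pathfinish c = a + of_real (d / 2)"
    "path_image c = Elementary_Metric_Spaces.sphere a (d / 2)" "winding_number c a = 1"
    using d(1) by (simp_all add: c_def winding_number_circlepath_centre)
  have cb: "cball a (d / 2) \<subseteq> - (A - {a})"
  proof
    fix w
    assume "w \<in> cball a (d / 2)"
    then have "\<not> d \<le> dist a w"
      using d(1) by simp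
    then show "w \<in> - (A - {a})"
      using d(2)[of w] by blast
  qed
  have sp: "Elementary_Metric_Spaces.sphere a (d / 2) \<subseteq> - A"
    using cb d(1) by (auto simp: subset_iff)
  have "a + of_real (d / 2) \<in> - A"
    using sp d(1) by (auto simp: dist_norm subset_iff)
  moreover have "path_connected (- A)"
    using assms(1) by (intro path_connected_complement_countable) (auto intro: countable_finite)
  ultimately obtain g where g: "path g" "path_image g \<subseteq> - A" "pathstart g = \<zeta>"
    "pathfinish g = a + of_real (d / 2)"
    using assms(3) unfolding path_connected_def by blast
  define y where "y = g +++ c +++ reversepath g"
  have a: "a \<notin> path_image g" "a \<notin> path_image c"
    using g(2) assms(2) c(4) d(1) by auto
  have "winding_number y a = winding_number g a + (winding_number c a + winding_number (reversepath g) a)"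
    unfolding y_def using g c a by (simp add: winding_number_join path_image_join)
  then have wn: "winding_number y a = 1"
    using winding_number_reversepath[OF g(1) a(1)] c(5) by simp
  have "null_loop (- (A - {a})) c"
    by (rule null_loop_convex[OF _ _ _ _ cb]) (use c sphere_cball in auto)
  moreover have "homotopic_loops (- (A - {a})) c y"
    unfolding y_def
    by (rule homotopic_loops_sym[OF homotopic_loops_conjugate]) (use g c sp in auto)
  ultimately have "null_loop (- (A - {a})) y"
    by (rule null_loop_homotopic)
  then show ?thesis
    using that[of y] wn g c sp by (auto simp: y_def path_image_join)
qed

text \<open>A contractible commutator would make \<open>x\<close> commute with the lasso around
  \<open>a\<close>. As \<open>x\<close> does not wind around \<open>a\<close> and the lasso does so
  once, \<open>x\<close> would be contractible.\<close>

lemma comm_loop_not_null: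
  fixes A :: "complex set"
  assumes "finite A" "a \<in> A" "\<not> null_loop (- A) x" "winding_number x a = 0"
    "path x" "pathfinish x = pathstart x" "path_image x \<subseteq> - A"
  obtains y where "path y" "pathstart y = pathstart x" "pathfinish y = pathstart x"
    "path_image y \<subseteq> - A" "null_loop (- (A - {a})) y" "\<not> null_loop (- A) (comm_loop x y)"
proof -
  have "pathstart x \<notin> A"
    using assms(7) pathstart_in_path_image[of x] by auto
  then obtain y where y: "path y" "pathstart y = pathstart x" "pathfinish y = pathstart x"
    "path_image y \<subseteq> - A" "winding_number y a = 1" "null_loop (- (A - {a})) y"
    using puncture_loop[OF assms(1,2)] by metis
  have "\<not> homotopic_paths (- A) (x +++ y) (y +++ x)"
    using commuting_loop_null[OF countable_finite[OF assms(1)] assms(2) _ assms(5) y(1) assms(6) y(2,3)]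
      assms(3,4) y(5) by blast
  then have "\<not> null_loop (- A) (comm_loop x y)"
    using null_comm_loop_iff[OF assms(5) y(1) assms(6) y(2,3)] by blast
  then show ?thesis
    using that y by blast
qed

text \<open>For a new puncture \<open>d\<close>, take the commutator with a lasso around
  \<open>d\<close>: filling in \<open>d\<close> kills the lasso, filling in an old puncture kills
  the previous loop. The previous loop does not wind around \<open>d\<close>, because it contracts
  in the presence of \<open>d\<close> when some \<open>e \<in> D\<close> is filled in; this needs
  \<open>D\<close> nonempty.\<close>

lemma brunnian_loop_finite:
  fixes A :: "complex set"
  assumes "finite A" "\<zeta> \<notin> A" "D \<subseteq> A" "D \<noteq> {}"
  shows "\<exists>x. path x \<and> pathstart x = \<zeta> \<and> pathfinish x = \<zeta> \<and> path_image x \<subseteq> - A \<and>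
           \<not> null_loop (- A) x \<and> (\<forall>d\<in>D. null_loop (- (A - {d})) x)"
  using finite_subset[OF assms(3,1)] assms(4,3)
proof (induction D rule: finite_ne_induct)
  case (singleton d)
  then obtain y where y: "path y" "pathstart y = \<zeta>" "pathfinish y = \<zeta>" "path_image y \<subseteq> - A"
    "winding_number y d = 1" "null_loop (- (A - {d})) y"
    using puncture_loop[OF assms(1) _ assms(2)] by (metis insert_subset)
  have "\<not> null_loop (- A) y"
    using null_loop_winding_number[of "- A" y d] y(5) singleton by auto
  then show ?case
    using y by blast
next
  case (insert d D)
  then obtain x where x: "path x" "pathstart x = \<zeta>" "pathfinish x = \<zeta>" "path_image x \<subseteq> - A"
    "\<not> null_loop (- A) x" "\<And>e. e \<in> D \<Longrightarrow> null_loop (- (A - {e})) x"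
    by auto
  obtain e where e: "e \<in> D"
    using insert by blast
  have "winding_number x d = 0"
    by (rule null_loop_winding_number[OF x(6)[OF e]]) (use insert e in auto)
  then obtain y where y: "path y" "pathstart y = \<zeta>" "pathfinish y = \<zeta>"
    "path_image y \<subseteq> - A" "null_loop (- (A - {d})) y" "\<not> null_loop (- A) (comm_loop x y)"
    using comm_loop_not_null[OF assms(1) _ x(5) _ x(1) _ x(4), of d] x insert by auto
  have "null_loop (- (A - {f})) (comm_loop x y)" if "f \<in> insert d D" for f
    by (rule null_comm_loop) (use that x y in auto)
  then show ?case
    using x y by (intro exI[of _ "comm_loop x y"]) auto
qed

text \<open>The last conclusion says that the loop contracts when infinity is filled in. Inversion
  makes infinity the puncture 0, and one more commutator, with a lasso around 0 in the inverted
  plane, deals with it. The earlier contractions survive, since \<open>null_comm_loop\<close> asks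
  only one factor to contract.\<close>

lemma brunnian_loop:
  fixes A :: "complex set"
  assumes "finite A" "0 \<in> A" "1 \<in> A" "\<zeta> \<notin> A"
  obtains x where "path x" "pathstart x = \<zeta>" "pathfinish x = \<zeta>" "path_image x \<subseteq> - A"
    "\<not> null_loop (- A) x" "\<And>d. d \<in> A \<Longrightarrow> null_loop (- (A - {d})) x"
    "null_loop (- (inverse ` (A - {0}))) (inverse \<circ> x)"
proof -
  obtain x where x: "path x" "pathstart x = \<zeta>" "pathfinish x = \<zeta>" "path_image x \<subseteq> - A"
    "\<not> null_loop (- A) x" "\<And>d. d \<in> A \<Longrightarrow> null_loop (- (A - {d})) x"
    using brunnian_loop_finite[OF assms(1,4), of A] assms(2) by auto
  define A' where "A' = insert 0 (inverse ` (A - {0}))"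
  have A': "finite A'" "0 \<in> A'" "A' - {0} = inverse ` (A - {0})"
    using assms by (auto simp: A'_def)
  have inv_A: "inverse ` (- A) \<subseteq> - A'" "inverse ` (- A') \<subseteq> - A"
    using assms(2) by (auto simp: A'_def image_iff) (metis DiffI inverse_inverse_eq inverse_zero singletonD)
  have cont: "continuous_on (- A) inverse" "continuous_on (- A') inverse"
    using assms(2) A'(2) by (auto intro!: continuous_intros)
  define x' where "x' = inverse \<circ> x"
  have x': "path x'" "pathstart x' = inverse \<zeta>" "pathfinish x' = inverse \<zeta>" "path_image x' \<subseteq> - A'"
    using x inv_A by (auto simp: x'_def pathstart_compose pathfinish_compose path_image_compose
        intro!: path_continuous_image continuous_on_subset[OF cont(1)])
  \<comment> \<open>Filling in 1 contracts \<open>x\<close> while 0 stays a puncture, so the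
    inverted contraction remains finite and nonzero.\<close>
  have "null_loop (- {0}) x'"
    unfolding x'_def
    by (rule null_loop_image[OF x(6)[OF assms(3)]]) (use assms(2) in \<open>auto intro!: continuous_intros\<close>)
  then have "winding_number x' 0 = 0"
    by (rule null_loop_winding_number) auto
  moreover have "\<not> null_loop (- A') x'"
  proof
    assume "null_loop (- A') x'"
    then have "null_loop (- A) (inverse \<circ> x')"
      by (rule null_loop_image) (use cont inv_A in auto)
    then show False
      using x(5) by (simp add: x'_def o_def)
  qed
  ultimately obtain y where y: "path y" "pathstart y = pathstart x'" "pathfinish y = pathstart x'"
    "path_image y \<subseteq> - A'" "null_loop (- (A' - {0})) y" "\<not> null_loop (- A') (comm_loop x' y)"
    using comm_loop_not_null[OF A'(1,2), of x'] x' by auto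
  define y' where "y' = inverse \<circ> y"
  have "path_image y' \<subseteq> inverse ` (- A')"
    using y(4) unfolding y'_def path_image_compose by (rule image_mono)
  then have "path_image y' \<subseteq> - A"
    using inv_A(2) by (rule subset_trans)
  then have y': "path y'" "pathstart y' = \<zeta>" "pathfinish y' = \<zeta>" "path_image y' \<subseteq> - A"
    using x' y by (auto simp: y'_def pathstart_compose pathfinish_compose path_image_compose
        intro!: path_continuous_image continuous_on_subset[OF cont(2)])
  have inv_comm: "inverse \<circ> comm_loop x y' = comm_loop x' y"
    by (simp add: comm_loop_compose x'_def y'_def o_assoc) (simp add: o_def)
  show ?thesis
  proof (rule that[of "comm_loop x y'"])
    show "\<not> null_loop (- A) (comm_loop x y')"
    proof
      assume "null_loop (- A) (comm_loop x y')"
      then have "null_loop (- A') (inverse \<circ> comm_loop x y')"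
        by (rule null_loop_image) (use cont inv_A in auto)
      then show False
        using y(6) by (simp add: inv_comm)
    qed
    show "null_loop (- (A - {d})) (comm_loop x y')" if "d \<in> A" for d
      by (rule null_comm_loop) (use that x y' in auto)
    show "null_loop (- (inverse ` (A - {0}))) (inverse \<circ> comm_loop x y')"
      unfolding inv_comm A'(3)[symmetric]
      by (rule null_comm_loop) (use x' y in auto)
  qed (use x y' in auto)
qed

section \<open>Holomorphic approximation on the unit circle\<close>

text \<open>The surface \<^const>\<open>Defs.sphere\<close> hides the metric sphere of HOL-Analysis.\<close>

abbreviation unit_circle :: "complex set" where
  "unit_circle \<equiv> Elementary_Metric_Spaces.sphere 0 1"

text \<open>On the unit circle \<open>cnj z = inverse z\<close>, so real and imaginary part agree
  there with Laurent polynomials, and sums and products follow.\<close>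

lemma real_polynomial_on_circle_holomorphic:
  assumes "real_polynomial_function (p :: complex \<Rightarrow> real)"
  shows "\<exists>F. F holomorphic_on - {0} \<and> (\<forall>z\<in>unit_circle. F z = of_real (p z))"
  using assms
proof (induction p rule: real_polynomial_function.induct)
  case (linear f)
  define F where "F = (\<lambda>z. (z + inverse z) / 2 * of_real (f 1) + (z - inverse z) / (2 * \<i>) * of_real (f \<i>))"
  have "F z = of_real (f z)" if "z \<in> unit_circle" for z
  proof -
    have n: "norm z = 1"
      using that by simp
    then have "z \<noteq> 0"
      by auto
    moreover have "z * cnj z = 1"
      using complex_norm_square[of z] n by simp
    ultimately have "inverse z = cnj z"
      by (simp add: inverse_unique)
    then have "(z + inverse z) / 2 = of_real (Re z)" "(z - inverse z) / (2 * \<i>) = of_real (Im z)"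
      by (auto simp: complex_eq_iff)
    then have "F z = of_real (Re z) * of_real (f 1) + of_real (Im z) * of_real (f \<i>)"
      by (simp only: F_def)
    moreover have "f z = f (Re z *\<^sub>R 1 + Im z *\<^sub>R \<i>)"
      by (rule arg_cong[of _ _ f]) (simp add: complex_eq_iff)
    ultimately show ?thesis
      using linear by (simp add: linear_simps)
  qed
  moreover have "F holomorphic_on - {0}"
    unfolding F_def by (intro holomorphic_intros) auto
  ultimately show ?case
    by blast
next
  case (const c)
  then show ?case
    by (intro exI[of _ "\<lambda>_. of_real c"]) auto
next
  case (add f g)
  then obtain F G where "F holomorphic_on - {0} \<and> (\<forall>z\<in>unit_circle. F z = of_real (f z))"
    "G holomorphic_on - {0} \<and> (\<forall>z\<in>unit_circle. G z = of_real (g z))"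
    by blast
  then show ?case
    by (intro exI[of _ "\<lambda>z. F z + G z"]) (simp add: holomorphic_on_add)
next
  case (mult f g)
  then obtain F G where "F holomorphic_on - {0} \<and> (\<forall>z\<in>unit_circle. F z = of_real (f z))"
    "G holomorphic_on - {0} \<and> (\<forall>z\<in>unit_circle. G z = of_real (g z))"
    by blast
  then show ?case
    by (intro exI[of _ "\<lambda>z. F z * G z"]) (simp add: holomorphic_on_mult)
qed

lemma holomorphic_approximation_on_circle:
  fixes c :: "complex \<Rightarrow> complex"
  assumes "continuous_on unit_circle c" "e > 0"
  obtains F where "F holomorphic_on - {0}" "F 1 = c 1"
    "\<And>z. z \<in> unit_circle \<Longrightarrow> norm (F z - c z) < e"
proof -
  obtain g where g: "polynomial_function g" "\<And>z. z \<in> unit_circle \<Longrightarrow> norm (c z - g z) < e / 2"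
    using Stone_Weierstrass_polynomial_function[of "unit_circle" c "e / 2"] assms by auto
  have "real_polynomial_function (Re \<circ> g)" "real_polynomial_function (Im \<circ> g)"
    using g(1) bounded_linear_Re bounded_linear_Im unfolding polynomial_function_def by auto
  from this[THEN real_polynomial_on_circle_holomorphic]
  obtain P Q where PQ: "P holomorphic_on - {0}" "\<And>z. z \<in> unit_circle \<Longrightarrow> P z = of_real (Re (g z))"
    "Q holomorphic_on - {0}" "\<And>z. z \<in> unit_circle \<Longrightarrow> Q z = of_real (Im (g z))"
    unfolding comp_apply by blast
  \<comment> \<open>The added constant restores the exact value at 1, the base point of all loops.
    It doubles the error, hence the tolerance \<open>e / 2\<close> above.\<close>
  define F where "F = (\<lambda>z. P z + \<i> * Q z + (c 1 - g 1))"
  have F: "F z = g z + (c 1 - g 1)" if "z \<in> unit_circle" for z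
    using PQ(2,4)[OF that] by (simp add: F_def complex_eq_iff)
  show ?thesis
  proof
    show "F holomorphic_on - {0}"
      unfolding F_def using PQ by (intro holomorphic_intros)
    show "F 1 = c 1"
      using F[of 1] by simp
    fix z :: complex
    assume z: "z \<in> unit_circle"
    have "norm (F z - c z) = norm ((c 1 - g 1) - (c z - g z))"
      by (simp add: F[OF z] algebra_simps)
    also have "\<dots> \<le> norm (c 1 - g 1) + norm (c z - g z)"
      by (rule norm_triangle_ineq4)
    also have "\<dots> < e / 2 + e / 2"
      using g(2)[of 1] g(2)[OF z] by (intro add_strict_mono) auto
    finally show "norm (F z - c z) < e"
      by simp
  qed
qed

lemma circle_function_of_loop:
  assumes "path \<gamma>" "pathfinish \<gamma> = pathstart \<gamma>"
  obtains c where "continuous_on unit_circle c" "\<And>t. t \<in> {0..1} \<Longrightarrow> c (circlepath 0 1 t) = \<gamma> t"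
proof
  define c where "c = \<gamma> \<circ> (\<lambda>z. Arg2pi z / (2 * pi))"
  \<comment> \<open>The trivial self-homotopy, transported to circle maps, carries the continuity of
    the loop across the jump of \<open>Arg2pi\<close>.\<close>
  have "homotopic_loops UNIV \<gamma> \<gamma>"
    using assms by (simp add: homotopic_loops_refl)
  then have "homotopic_with_canon (\<lambda>h. True) unit_circle UNIV c c"
    unfolding c_def by (rule homotopic_loops_imp_homotopic_circlemaps)
  then show "continuous_on unit_circle c"
    using homotopic_with_imp_continuous by blast
  fix t :: real
  assume t: "t \<in> {0..1}"
  show "c (circlepath 0 1 t) = \<gamma> t"
  proof (cases "t = 1")
    case True
    have "Arg2pi 1 = 0"
      by (simp add: Arg2pi_eq_0)
    then show ?thesis
      using True assms(2) by (simp add: c_def circlepath pathstart_def pathfinish_def exp_two_pi_i)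
  next
    case False
    then have "Arg2pi (exp (2 * of_real pi * \<i> * of_real t)) = 2 * pi * t"
      using t by (subst Arg2pi_exp) auto
    then show ?thesis
      by (simp add: c_def circlepath)
  qed
qed

text \<open>Holomorphic functions cannot be nonnegative with small support. The substitutes are
  small total weight away from \<open>p\<close> and total absolute weight close to 1, while the sum
  stays exactly 1 everywhere.\<close>

lemma holomorphic_partition_of_unity_circle:
  fixes r \<eta> :: real
  assumes "r > 0" "\<eta> > 0"
  obtains J B where "finite J" "J \<subseteq> unit_circle"
    "\<And>s. s \<in> J \<Longrightarrow> B s holomorphic_on - {0}"
    "\<And>p. (\<Sum>s\<in>J. B s p) = 1"
    "\<And>p. p \<in> unit_circle \<Longrightarrow> (\<Sum>s\<in>{s \<in> J. r \<le> dist p s}. norm (B s p)) \<le> \<eta>"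
    "\<And>p. p \<in> unit_circle \<Longrightarrow> (\<Sum>s\<in>J. norm (B s p)) \<le> 1 + \<eta>"
proof -
  let ?S = "unit_circle"
  have "?S \<subseteq> (\<Union>s\<in>?S. ball s r)"
    using assms(1) by fastforce
  then obtain J where J: "J \<subseteq> ?S" "finite J" "?S \<subseteq> (\<Union>s\<in>J. ball s r)"
    using compactE_image[of ?S ?S "\<lambda>s. ball s r"] by auto
  have "(1 :: complex) \<in> ?S"
    by simp
  then have J0: "J \<noteq> {}"
    using J(3) by blast
  define u where "u = (\<lambda>s p :: complex. max 0 (r - dist p s))"
  define U where "U = (\<lambda>p. \<Sum>s\<in>J. u s p)"
  define b where "b = (\<lambda>s p. u s p / U p)"
  have u0: "u s p \<ge> 0" for s p
    by (simp add: u_def)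
  have U0: "U p > 0" if p: "p \<in> ?S" for p
  proof -
    obtain s where s: "s \<in> J" "p \<in> ball s r"
      using J(3) p by blast
    then have "u s p > 0"
      by (simp add: u_def dist_commute)
    then show ?thesis
      unfolding U_def using J(2) s(1) u0 by (intro sum_pos2[of J s]) auto
  qed
  have b0: "b s p \<ge> 0" if "p \<in> ?S" for s p
    using u0 U0[OF that] by (simp add: b_def)
  have b1: "(\<Sum>s\<in>J. b s p) = 1" if "p \<in> ?S" for p
    using U0[OF that] by (simp add: b_def U_def sum_divide_distrib[symmetric])
  define \<eta>' where "\<eta>' = \<eta> / (2 * real (card J))"
  have cJ: "real (card J) > 0"
    using J(2) J0 by (simp add: card_gt_0_iff)
  have "\<exists>F. F holomorphic_on - {0} \<and> (\<forall>p\<in>?S. norm (F p - of_real (b s p)) < \<eta>')" for s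
  proof -
    have "continuous_on ?S (\<lambda>p. complex_of_real (b s p))"
      unfolding b_def u_def U_def using U0 by (intro continuous_intros) (auto simp: U_def u_def less_imp_neq[symmetric])
    moreover have "\<eta>' > 0"
      using cJ assms(2) by (simp add: \<eta>'_def)
    ultimately obtain F where "F holomorphic_on - {0}"
      "\<And>z. z \<in> ?S \<Longrightarrow> norm (F z - of_real (b s z)) < \<eta>'"
      by (rule holomorphic_approximation_on_circle) blast
    then show ?thesis
      by blast
  qed
  then obtain F where F: "\<And>s. F s holomorphic_on - {0}"
    "\<And>s p. p \<in> ?S \<Longrightarrow> norm (F s p - of_real (b s p)) < \<eta>'"
    by metis
  \<comment> \<open>The defect of the sum is spread evenly over \<open>J\<close>, which makes the
    sum 1 identically, even off the circle. Each term then deviates from \<open>b s\<close> by at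
    most \<open>2 * \<eta>'\<close>, in total by \<open>\<eta>\<close>.\<close>
  define B where "B = (\<lambda>s p. F s p + (1 - (\<Sum>s\<in>J. F s p)) / of_nat (card J))"
  have Bb: "norm (B s p - of_real (b s p)) \<le> 2 * \<eta>'" if p: "p \<in> ?S" for s p
  proof -
    have "norm (1 - (\<Sum>s\<in>J. F s p)) = norm (\<Sum>s\<in>J. F s p - of_real (b s p))"
      using b1[OF p] by (simp add: sum_subtractf norm_minus_commute flip: of_real_sum)
    also have "\<dots> \<le> of_nat (card J) * \<eta>'"
      using F(2)[OF p] by (intro sum_norm_bound) (auto intro: less_imp_le)
    finally have "norm ((1 - (\<Sum>s\<in>J. F s p)) / of_nat (card J)) \<le> \<eta>'"
      using cJ by (simp add: norm_divide field_simps)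
    moreover have eq: "B s p - of_real (b s p) = (F s p - of_real (b s p)) + (1 - (\<Sum>s\<in>J. F s p)) / of_nat (card J)"
      by (simp add: B_def)
    ultimately show ?thesis
      unfolding eq using F(2)[OF p, of s] by (intro norm_triangle_le) linarith
  qed
  show ?thesis
  proof (rule that[of J B])
    show "(\<Sum>s\<in>J. B s p) = 1" for p
      using cJ by (simp add: B_def sum.distrib)
    show "B s holomorphic_on - {0}" for s
      unfolding B_def using F(1) cJ by (intro holomorphic_intros) auto
    fix p
    assume p: "p \<in> ?S"
    let ?K = "{s \<in> J. r \<le> dist p s}"
    have "norm (B s p) \<le> 2 * \<eta>'" if "s \<in> ?K" for s
    proof -
      have "b s p = 0"
        using that by (simp add: b_def u_def)
      then show ?thesis
        using Bb[OF p, of s] by simp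
    qed
    then have "(\<Sum>s\<in>?K. norm (B s p)) \<le> real (card ?K) * (2 * \<eta>')"
      by (rule sum_bounded_above)
    also have "\<dots> \<le> real (card J) * (2 * \<eta>')"
      using J(2) cJ assms(2) by (intro mult_right_mono) (auto simp: \<eta>'_def intro!: card_mono)
    finally show "(\<Sum>s\<in>?K. norm (B s p)) \<le> \<eta>"
      using cJ by (simp add: \<eta>'_def)
    have "norm (B s p) \<le> b s p + 2 * \<eta>'" for s
      using Bb[OF p, of s] b0[OF p, of s] norm_triangle_ineq2[of "B s p" "of_real (b s p)"] by simp
    then have "(\<Sum>s\<in>J. norm (B s p)) \<le> (\<Sum>s\<in>J. b s p + 2 * \<eta>')"
      by (intro sum_mono)
    also have "\<dots> = 1 + \<eta>"
      using cJ b1[OF p] by (simp add: sum.distrib \<eta>'_def)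
    finally show "(\<Sum>s\<in>J. norm (B s p)) \<le> 1 + \<eta>" .
  qed (use J in auto)
qed

section \<open>Holomorphic motions of the plane along null-homotopic loops\<close>

definition ann :: "real \<Rightarrow> complex set" where
  "ann e = {p. 1 - e < norm p \<and> norm p < 1 + e}"

definition cann :: "real \<Rightarrow> complex set" where
  "cann e = {p. 1 - e \<le> norm p \<and> norm p \<le> 1 + e}"

lemma ann_open [simp]: "open (ann e)"
  unfolding ann_def by (intro open_Collect_conj open_Collect_less continuous_intros)

lemma cann_compact [simp]: "compact (cann e)"
proof -
  have "cann e = cball 0 (1 + e) - ball 0 (1 - e)"
    by (auto simp: cann_def)
  then show ?thesis
    by (simp add: compact_diff)
qed

lemma sphere_subset_ann: "e > 0 \<Longrightarrow> unit_circle \<subseteq> ann e"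
  by (auto simp: ann_def)

lemma ann_mono: "d \<le> e \<Longrightarrow> ann d \<subseteq> ann e"
  by (auto simp: ann_def)

lemma dist_sgn:
  fixes p :: complex
  assumes "p \<noteq> 0"
  shows "dist p (sgn p) = \<bar>norm p - 1\<bar>"
proof -
  have "p - sgn p = of_real (norm p - 1) * sgn p"
    using assms by (simp add: sgn_eq field_simps)
  then have "dist p (sgn p) = norm (of_real (norm p - 1) * sgn p)"
    by (simp only: dist_norm)
  also have "\<dots> = \<bar>norm p - 1\<bar> * norm (sgn p)"
    by (simp only: norm_mult norm_of_real)
  finally show ?thesis
    using assms by (simp add: norm_sgn)
qed

lemma zero_notin_ann: "e \<le> 1 \<Longrightarrow> 0 \<notin> ann e"
  by (auto simp: ann_def)

text \<open>\<open>quasi_motion e P \<zeta> g \<psi>\<close>: the maps \<open>\<psi> p\<close>, for \<open>p\<close> in an annulus around the unit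
  circle, fix \<open>P\<close>, move \<open>\<zeta>\<close> along \<open>g\<close>, and are bi-Lipschitz over the circle itself; their
  dependence on \<open>p\<close> is uniformly continuous for the Lipschitz seminorm in \<open>z\<close>, so that
  injectivity persists on a thinner annulus.\<close>

definition quasi_motion ::
  "real \<Rightarrow> complex set \<Rightarrow> complex \<Rightarrow> (complex \<Rightarrow> complex) \<Rightarrow> (complex \<Rightarrow> complex \<Rightarrow> complex) \<Rightarrow> bool"
where
  "quasi_motion e P \<zeta> g \<psi> \<longleftrightarrow>
     (\<forall>z. (\<lambda>p. \<psi> p z) holomorphic_on ann e) \<and>
     (\<forall>z. \<psi> 1 z = z) \<and>
     (\<forall>p\<in>ann e. \<forall>z\<in>P. \<psi> p z = z) \<and>
     (\<forall>p\<in>ann e. \<psi> p \<zeta> = g p) \<and>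
     (\<exists>C. \<forall>p\<in>cann (e/2). \<forall>z. norm (\<psi> p z - z) \<le> C) \<and>
     (\<exists>L. \<forall>p\<in>cann (e/2). \<forall>z w. norm (\<psi> p z - \<psi> p w) \<le> L * norm (z - w)) \<and>
     (\<exists>m>0. \<forall>p\<in>unit_circle. \<forall>z w. m * norm (z - w) \<le> norm (\<psi> p z - \<psi> p w)) \<and>
     (\<forall>\<epsilon>>0. \<exists>\<delta>>0. \<forall>p\<in>cann (e/2). \<forall>q\<in>cann (e/2). dist p q < \<delta> \<longrightarrow>
        (\<forall>z w. norm ((\<psi> p z - \<psi> p w) - (\<psi> q z - \<psi> q w)) \<le> \<epsilon> * norm (z - w)))"

lemma quasi_motion_id:
  "quasi_motion e P \<zeta> (\<lambda>_. \<zeta>) (\<lambda>_ z. z)"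
  unfolding quasi_motion_def
  by (intro conjI allI impI exI[of _ 0] exI[of _ "1 :: real"]) auto

text \<open>The correction \<open>h - g\<close> is multiplied by a bump function of \<open>\<psi> s z - g s\<close>, taken at
  finitely many \<open>s\<close> and averaged by a holomorphic partition of unity. Only the Lipschitz constant
  \<open>1 / d\<close> of the bump relative to \<open>\<psi>\<close> matters, so the admissible step size \<open>d / 4\<close> does not
  depend on \<open>\<psi>\<close> and the steps can be iterated.\<close>

lemma quasi_motion_step:
  assumes qm: "quasi_motion e P \<zeta> g \<psi>" and e: "0 < e" "e \<le> 1" and d: "d > 0"
    and g: "\<And>p z. p \<in> unit_circle \<Longrightarrow> z \<in> P \<Longrightarrow> d \<le> norm (z - g p)"
    and h: "g holomorphic_on ann e" "h holomorphic_on ann e" "h 1 = \<zeta>"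
    and near: "\<And>p. p \<in> unit_circle \<Longrightarrow> norm (h p - g p) \<le> d / 4"
  shows "\<exists>\<psi>. quasi_motion e P \<zeta> h \<psi>"
proof -
  let ?S = "unit_circle" and ?K = "cann (e/2)"
  have SK: "?S \<subseteq> ?K" and KA: "?K \<subseteq> ann e" and A0: "ann e \<subseteq> - {0}"
    using e zero_notin_ann[of e] by (auto simp: cann_def ann_def)
  have one: "1 \<in> ann e" "1 \<in> ?S"
    using e by (auto simp: ann_def)
  have q: "\<And>z. (\<lambda>p. \<psi> p z) holomorphic_on ann e" "\<And>z. \<psi> 1 z = z"
    "\<And>p z. p \<in> ann e \<Longrightarrow> z \<in> P \<Longrightarrow> \<psi> p z = z" "\<And>p. p \<in> ann e \<Longrightarrow> \<psi> p \<zeta> = g p"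
    using qm unfolding quasi_motion_def by blast+
  have "\<exists>C. \<forall>p\<in>?K. \<forall>z. norm (\<psi> p z - z) \<le> C"
    using qm unfolding quasi_motion_def by (elim conjE)
  then obtain C where C: "\<And>p z. p \<in> ?K \<Longrightarrow> norm (\<psi> p z - z) \<le> C"
    by blast
  have "\<exists>L. \<forall>p\<in>?K. \<forall>z w. norm (\<psi> p z - \<psi> p w) \<le> L * norm (z - w)"
    using qm unfolding quasi_motion_def by (elim conjE)
  then obtain L where L: "\<And>p z w. p \<in> ?K \<Longrightarrow> norm (\<psi> p z - \<psi> p w) \<le> L * norm (z - w)"
    by blast
  have "\<exists>m>0. \<forall>p\<in>?S. \<forall>z w. m * norm (z - w) \<le> norm (\<psi> p z - \<psi> p w)"
    using qm unfolding quasi_motion_def by (elim conjE)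
  then obtain m where m: "m > 0" "\<And>p z w. p \<in> ?S \<Longrightarrow> m * norm (z - w) \<le> norm (\<psi> p z - \<psi> p w)"
    by blast
  have cont: "\<exists>\<delta>>0. \<forall>p\<in>?K. \<forall>q\<in>?K. dist p q < \<delta> \<longrightarrow>
        (\<forall>z w. norm ((\<psi> p z - \<psi> p w) - (\<psi> q z - \<psi> q w)) \<le> \<epsilon> * norm (z - w))" if "\<epsilon> > 0" for \<epsilon>
    using qm that unfolding quasi_motion_def by (elim conjE) simp
  have L0: "L \<ge> 0"
    using L[of 1 0 1] subsetD[OF SK one(2)] by (simp add: q(2))
  obtain r where r: "r > 0" "\<And>p q z w. p \<in> ?K \<Longrightarrow> q \<in> ?K \<Longrightarrow> dist p q < r \<Longrightarrow>
      norm ((\<psi> p z - \<psi> p w) - (\<psi> q z - \<psi> q w)) \<le> m / 4 * norm (z - w)"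
    using cont[of "m / 4"] m(1) by (auto simp: Ball_def)
  \<comment> \<open>Far weights of total \<open>\<eta>\<close>, multiplied by the Lipschitz constant
    \<open>L\<close>, cost at most \<open>m / 4\<close>, and all weights together stay below 3/2.
    \<open>L + 1\<close> keeps the denominator positive.\<close>
  define \<eta> where "\<eta> = min (1/2) (m / (4 * (L + 1)))"
  have \<eta>: "\<eta> > 0" "\<eta> \<le> 1/2" "\<eta> * L \<le> m / 4"
  proof -
    show "\<eta> > 0"
      using L0 m(1) by (auto simp: \<eta>_def)
    show "\<eta> \<le> 1/2"
      unfolding \<eta>_def by (rule min.cobounded1)
    have "\<eta> * L \<le> m / (4 * (L + 1)) * (L + 1)"
      using L0 m(1) by (intro mult_mono) (auto simp: \<eta>_def)
    also have "\<dots> = m / 4"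
    proof -
      have "L + 1 \<noteq> 0"
        using L0 by linarith
      then show ?thesis
        unfolding times_divide_eq_left by (rule mult_divide_mult_cancel_right)
    qed
    finally show "\<eta> * L \<le> m / 4" .
  qed
  obtain J B where J: "finite J" "J \<subseteq> ?S" "\<And>s. s \<in> J \<Longrightarrow> B s holomorphic_on - {0}"
    "\<And>p. (\<Sum>s\<in>J. B s p) = 1"
    "\<And>p. p \<in> ?S \<Longrightarrow> (\<Sum>s\<in>{s \<in> J. r \<le> dist p s}. norm (B s p)) \<le> \<eta>"
    "\<And>p. p \<in> ?S \<Longrightarrow> (\<Sum>s\<in>J. norm (B s p)) \<le> 1 + \<eta>"
    by (rule holomorphic_partition_of_unity_circle[OF r(1) \<eta>(1)]) (rule that)
  have JS: "s \<in> ?S" "s \<in> ?K" "s \<in> ann e" if "s \<in> J" for s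
    using that J(2) SK KA by blast+
  define v where "v = (\<lambda>p. h p - g p)"
  \<comment> \<open>The bump is not holomorphic in its argument, so it is frozen at sample points
    \<open>s\<close>; the parameter \<open>p\<close> enters only through \<open>F\<close>. It equals
    1 at \<open>\<zeta>\<close>, which sits at \<open>g s\<close>, and 0 on \<open>P\<close>, which
    keeps distance \<open>d\<close> from \<open>g s\<close>.\<close>
  define \<beta> where "\<beta> = (\<lambda>s z. max 0 (1 - norm (\<psi> s z - g s) / d))"
  define F where "F = (\<lambda>s p. v p * B s p)"
  define \<psi>' where "\<psi>' = (\<lambda>p z. \<psi> p z + (\<Sum>s\<in>J. F s p * of_real (\<beta> s z)))"
  have v1: "v 1 = 0"
    using h(3) q(2)[of \<zeta>] q(4)[OF one(1)] by (simp add: v_def)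
  have \<beta>b: "0 \<le> \<beta> s z" "\<beta> s z \<le> 1" for s z
    using d by (auto simp: \<beta>_def)
  have \<beta>L: "\<bar>\<beta> s z - \<beta> s w\<bar> \<le> norm (\<psi> s z - \<psi> s w) / d" for s z w
  proof -
    have "\<bar>\<beta> s z - \<beta> s w\<bar> \<le> \<bar>norm (\<psi> s z - g s) / d - norm (\<psi> s w - g s) / d\<bar>"
      by (simp add: \<beta>_def max_def abs_if)
    also have "\<dots> = \<bar>norm (\<psi> s z - g s) - norm (\<psi> s w - g s)\<bar> / d"
      using d by (simp add: diff_divide_distrib[symmetric])
    also have "\<dots> \<le> norm ((\<psi> s z - g s) - (\<psi> s w - g s)) / d"
      using d norm_triangle_ineq3[of "\<psi> s z - g s" "\<psi> s w - g s"] by (intro divide_right_mono) auto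
    finally show ?thesis
      by simp
  qed
  have \<beta>L': "\<bar>\<beta> s z - \<beta> s w\<bar> \<le> L / d * norm (z - w)" if "s \<in> J" for s z w
  proof -
    have "norm (\<psi> s z - \<psi> s w) / d \<le> L * norm (z - w) / d"
      using L[of s z w] that J(2) SK d by (intro divide_right_mono) auto
    then show ?thesis
      using \<beta>L[of s z w] by simp
  qed
  have \<beta>P: "\<beta> s z = 0" if "s \<in> J" "z \<in> P" for s z
  proof -
    have "\<psi> s z = z" "d \<le> norm (z - g s)"
      using q(3)[OF JS(3) that(2)] g[OF JS(1) that(2)] that(1) by blast+
    then show ?thesis
      using d by (simp add: \<beta>_def)
  qed
  have \<beta>\<zeta>: "\<beta> s \<zeta> = 1" if "s \<in> J" for s
    using q(4)[OF JS(3)[OF that]] by (simp add: \<beta>_def)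
  have Fhol: "F s holomorphic_on ann e" if "s \<in> J" for s
    unfolding F_def v_def using h J(3)[OF that] A0
    by (intro holomorphic_intros) (auto intro: holomorphic_on_subset)
  have Fbd: "\<exists>M. \<forall>s\<in>J. \<forall>p\<in>?K. norm (F s p) \<le> M"
  proof -
    have "\<exists>M. \<forall>p\<in>?K. norm (F s p) \<le> M" if "s \<in> J" for s
    proof -
      have "continuous_on ?K (F s)"
        using Fhol[OF that] KA holomorphic_on_imp_continuous_on continuous_on_subset by blast
      then have "bounded (F s ` ?K)"
        using compact_continuous_image cann_compact compact_imp_bounded by blast
      then show ?thesis
        unfolding bounded_iff by blast
    qed
    then obtain M where M: "\<And>s p. s \<in> J \<Longrightarrow> p \<in> ?K \<Longrightarrow> norm (F s p) \<le> M s"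
      by metis
    have "M s \<le> (\<Sum>s\<in>J. \<bar>M s\<bar>)" if "s \<in> J" for s
      using member_le_sum[OF that, of "\<lambda>s. \<bar>M s\<bar>"] J(1) by force
    then show ?thesis
      using M by (meson order_trans)
  qed
  then obtain M where M: "\<And>s p. s \<in> J \<Longrightarrow> p \<in> ?K \<Longrightarrow> norm (F s p) \<le> M"
    by blast
  have diff: "\<psi>' p z - \<psi>' p w = (\<psi> p z - \<psi> p w) + (\<Sum>s\<in>J. F s p * of_real (\<beta> s z - \<beta> s w))" for p z w
    by (simp add: \<psi>'_def sum_subtractf algebra_simps)
  have hol: "(\<lambda>p. \<psi>' p z) holomorphic_on ann e" for z
    unfolding \<psi>'_def using q(1) Fhol by (intro holomorphic_intros) auto
  have base: "\<psi>' 1 z = z" for z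
    by (simp add: \<psi>'_def F_def v1 q(2))
  have fixP: "\<psi>' p z = z" if "p \<in> ann e" "z \<in> P" for p z
    using that q(3) \<beta>P by (simp add: \<psi>'_def)
  have track: "\<psi>' p \<zeta> = h p" if "p \<in> ann e" for p
  proof -
    have "\<psi>' p \<zeta> = g p + v p * (\<Sum>s\<in>J. B s p)"
      using q(4)[OF that] \<beta>\<zeta> by (simp add: \<psi>'_def F_def sum_distrib_left)
    then show ?thesis
      using J(4) by (simp add: v_def)
  qed
  have bdd: "norm (\<psi>' p z - z) \<le> C + real (card J) * M" if "p \<in> ?K" for p z
  proof -
    have "norm (\<Sum>s\<in>J. F s p * of_real (\<beta> s z)) \<le> real (card J) * M"
    proof (rule sum_norm_bound)
      fix s
      assume "s \<in> J"
      then have "norm (F s p) * \<bar>\<beta> s z\<bar> \<le> M * 1"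
        using M[OF _ that, of s] \<beta>b[of s z] by (intro mult_mono) (auto intro: order_trans[OF norm_ge_zero])
      then show "norm (F s p * of_real (\<beta> s z)) \<le> M"
        by (simp add: norm_mult)
    qed
    moreover have "norm (\<psi>' p z - z) \<le> norm (\<psi> p z - z) + norm (\<Sum>s\<in>J. F s p * of_real (\<beta> s z))"
      unfolding \<psi>'_def by (metis add_diff_eq add.commute norm_triangle_ineq)
    ultimately show ?thesis
      using C[OF that, of z] by linarith
  qed
  have lip: "norm (\<psi>' p z - \<psi>' p w) \<le> (L + real (card J) * (M * (L / d))) * norm (z - w)"
    if "p \<in> ?K" for p z w
  proof -
    have "norm (\<Sum>s\<in>J. F s p * of_real (\<beta> s z - \<beta> s w)) \<le> real (card J) * (M * (L / d * norm (z - w)))"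
    proof (rule sum_norm_bound)
      fix s
      assume s: "s \<in> J"
      then have "norm (F s p) * \<bar>\<beta> s z - \<beta> s w\<bar> \<le> M * (L / d * norm (z - w))"
        using M[OF _ that, of s] \<beta>L'[OF s] by (intro mult_mono) (auto intro: order_trans[OF norm_ge_zero])
      then show "norm (F s p * of_real (\<beta> s z - \<beta> s w)) \<le> M * (L / d * norm (z - w))"
        by (simp only: norm_mult norm_of_real)
    qed
    moreover have "norm (\<psi>' p z - \<psi>' p w) \<le> norm (\<psi> p z - \<psi> p w) + norm (\<Sum>s\<in>J. F s p * of_real (\<beta> s z - \<beta> s w))"
      unfolding diff by (rule norm_triangle_ineq)
    ultimately show ?thesis
      using L[OF that, of z w] by (simp add: algebra_simps)
  qed
  \<comment> \<open>Compare the increment of the correction with \<open>D\<close>. For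
    \<open>s\<close> near \<open>p\<close> the increments of \<open>\<psi> s\<close> and
    \<open>\<psi> p\<close> differ by at most \<open>D / 4\<close>, so the bump changes by at most
    \<open>5/4 * D / d\<close>; far \<open>s\<close> contribute \<open>D / (4 * d)\<close> by the
    choice of \<open>\<eta>\<close>. With the factor \<open>d / 4\<close> the correction eats 17/32
    of \<open>D\<close>, and the remaining 15/32 exceeds a quarter.\<close>
  have low: "m / 4 * norm (z - w) \<le> norm (\<psi>' p z - \<psi>' p w)" if p: "p \<in> ?S" for p z w
  proof -
    define D where "D = norm (\<psi> p z - \<psi> p w)"
    have mD: "m * norm (z - w) \<le> D"
      using m(2)[OF p] by (simp add: D_def)
    have D0: "D \<ge> 0"
      by (simp add: D_def)
    let ?far = "{s \<in> J. r \<le> dist p s}" and ?near = "{s \<in> J. \<not> r \<le> dist p s}"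
    have far: "(\<Sum>s\<in>?far. norm (B s p) * \<bar>\<beta> s z - \<beta> s w\<bar>) \<le> D / (4 * d)"
    proof -
      have "(\<Sum>s\<in>?far. norm (B s p) * \<bar>\<beta> s z - \<beta> s w\<bar>) \<le> (\<Sum>s\<in>?far. norm (B s p) * (L / d * norm (z - w)))"
        using \<beta>L' by (intro sum_mono mult_left_mono) auto
      also have "\<dots> = (\<Sum>s\<in>?far. norm (B s p)) * (L / d * norm (z - w))"
        by (rule sum_distrib_right[symmetric])
      also have "\<dots> \<le> \<eta> * (L / d * norm (z - w))"
        using J(5)[OF p] L0 d by (intro mult_right_mono) auto
      also have "\<dots> = (\<eta> * L) * norm (z - w) / d"
        by simp
      also have "\<dots> \<le> (m / 4) * norm (z - w) / d"
        using \<eta>(3) d by (intro divide_right_mono mult_right_mono) auto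
      also have "\<dots> \<le> (D / 4) / d"
        using mD d by (intro divide_right_mono) auto
      finally show ?thesis
        by simp
    qed
    have nr: "(\<Sum>s\<in>?near. norm (B s p) * \<bar>\<beta> s z - \<beta> s w\<bar>) \<le> 3/2 * (5/4 * D / d)"
    proof -
      have "\<bar>\<beta> s z - \<beta> s w\<bar> \<le> 5/4 * D / d" if s: "s \<in> ?near" for s
      proof -
        have "norm ((\<psi> s z - \<psi> s w) - (\<psi> p z - \<psi> p w)) \<le> m / 4 * norm (z - w)"
          using s p J(2) SK by (intro r(2)) (auto simp: dist_commute)
        then have "norm (\<psi> s z - \<psi> s w) \<le> D + m / 4 * norm (z - w)"
          using norm_triangle_ineq2[of "\<psi> s z - \<psi> s w" "\<psi> p z - \<psi> p w"] by (simp add: D_def)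
        also have "\<dots> \<le> 5/4 * D"
          using mD by simp
        finally have "norm (\<psi> s z - \<psi> s w) / d \<le> 5/4 * D / d"
          using d by (intro divide_right_mono) auto
        then show ?thesis
          using \<beta>L[of s z w] by linarith
      qed
      then have "(\<Sum>s\<in>?near. norm (B s p) * \<bar>\<beta> s z - \<beta> s w\<bar>) \<le> (\<Sum>s\<in>?near. norm (B s p) * (5/4 * D / d))"
        by (intro sum_mono mult_left_mono) auto
      also have "\<dots> = (\<Sum>s\<in>?near. norm (B s p)) * (5/4 * D / d)"
        by (rule sum_distrib_right[symmetric])
      also have "\<dots> \<le> (\<Sum>s\<in>J. norm (B s p)) * (5/4 * D / d)"
        using J(1) D0 d by (intro mult_right_mono sum_mono2) auto
      also have "\<dots> \<le> 3/2 * (5/4 * D / d)"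
        using J(6)[OF p] \<eta>(2) D0 d by (intro mult_right_mono) auto
      finally show ?thesis .
    qed
    have "J = ?far \<union> ?near"
      by blast
    then have "(\<Sum>s\<in>J. norm (B s p) * \<bar>\<beta> s z - \<beta> s w\<bar>) =
        (\<Sum>s\<in>?far \<union> ?near. norm (B s p) * \<bar>\<beta> s z - \<beta> s w\<bar>)"
      by (rule arg_cong)
    also have "\<dots> = (\<Sum>s\<in>?far. norm (B s p) * \<bar>\<beta> s z - \<beta> s w\<bar>) +
        (\<Sum>s\<in>?near. norm (B s p) * \<bar>\<beta> s z - \<beta> s w\<bar>)"
      using J(1) by (intro sum.union_disjoint) auto
    finally have split: "(\<Sum>s\<in>J. norm (B s p) * \<bar>\<beta> s z - \<beta> s w\<bar>) = \<dots>" .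
    have "norm (\<Sum>s\<in>J. F s p * of_real (\<beta> s z - \<beta> s w)) \<le> (\<Sum>s\<in>J. norm (F s p * of_real (\<beta> s z - \<beta> s w)))"
      by (rule norm_sum)
    also have "\<dots> = norm (v p) * (\<Sum>s\<in>J. norm (B s p) * \<bar>\<beta> s z - \<beta> s w\<bar>)"
      unfolding F_def norm_mult norm_of_real sum_distrib_left mult.assoc ..
    also have "\<dots> \<le> d / 4 * (D / (4 * d) + 3/2 * (5/4 * D / d))"
      unfolding split using near[OF p] far nr d by (intro mult_mono add_mono) (auto simp: v_def intro!: add_nonneg_nonneg sum_nonneg)
    also have "\<dots> = 17/32 * D"
      using d by (simp add: field_simps)
    finally have "norm (\<Sum>s\<in>J. F s p * of_real (\<beta> s z - \<beta> s w)) \<le> 17/32 * D" .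
    then have "D - 17/32 * D \<le> norm (\<psi>' p z - \<psi>' p w)"
      unfolding diff D_def
      using norm_diff_ineq[of "\<psi> p z - \<psi> p w" "\<Sum>s\<in>J. F s p * of_real (\<beta> s z - \<beta> s w)"] by linarith
    then show ?thesis
      using mD D0 by linarith
  qed
  have cont': "\<exists>\<delta>>0. \<forall>p\<in>?K. \<forall>q\<in>?K. dist p q < \<delta> \<longrightarrow>
        (\<forall>z w. norm ((\<psi>' p z - \<psi>' p w) - (\<psi>' q z - \<psi>' q w)) \<le> \<epsilon> * norm (z - w))"
    if "\<epsilon> > 0" for \<epsilon>
  proof -
    obtain \<delta>1 where \<delta>1: "\<delta>1 > 0" "\<And>p q z w. p \<in> ?K \<Longrightarrow> q \<in> ?K \<Longrightarrow> dist p q < \<delta>1 \<Longrightarrow>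
        norm ((\<psi> p z - \<psi> p w) - (\<psi> q z - \<psi> q w)) \<le> \<epsilon> / 2 * norm (z - w)"
      using cont[of "\<epsilon> / 2"] \<open>\<epsilon> > 0\<close> by (auto simp: Ball_def)
    \<comment> \<open>The summands 1 keep \<open>\<kappa>\<close> well defined and positive when
      \<open>J\<close> is empty or \<open>L\<close> vanishes.\<close>
    define a b where "a = real (card J) + 1" and "b = L / d + 1"
    define \<kappa> where "\<kappa> = \<epsilon> / (2 * a * b)"
    have Ld: "L / d \<ge> 0"
      using L0 d by simp
    have ab: "a > 0" "b > 0" "real (card J) \<le> a" "L / d \<le> b"
      using Ld by (auto simp: a_def b_def)
    have \<kappa>: "\<kappa> > 0"
      using ab \<open>\<epsilon> > 0\<close> by (simp add: \<kappa>_def)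
    have "\<exists>\<delta>>0. \<forall>p\<in>?K. \<forall>q\<in>?K. dist q p < \<delta> \<longrightarrow> dist (F s q) (F s p) < \<kappa>" if "s \<in> J" for s
    proof -
      have "continuous_on ?K (F s)"
        using Fhol[OF that] KA holomorphic_on_imp_continuous_on continuous_on_subset by blast
      then have "uniformly_continuous_on ?K (F s)"
        by (rule compact_uniformly_continuous) simp
      then show ?thesis
        using \<kappa> unfolding uniformly_continuous_on_def by blast
    qed
    then obtain \<delta>2 where \<delta>2: "\<And>s. s \<in> J \<Longrightarrow> \<delta>2 s > 0"
      "\<And>s p q. s \<in> J \<Longrightarrow> p \<in> ?K \<Longrightarrow> q \<in> ?K \<Longrightarrow> dist q p < \<delta>2 s \<Longrightarrow> dist (F s q) (F s p) < \<kappa>"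
      by metis
    define \<delta> where "\<delta> = Min (insert \<delta>1 (\<delta>2 ` J))"
    have \<delta>: "\<delta> > 0" "\<delta> \<le> \<delta>1" "\<And>s. s \<in> J \<Longrightarrow> \<delta> \<le> \<delta>2 s"
      using J(1) \<delta>1(1) \<delta>2(1) by (auto simp: \<delta>_def)
    have "norm ((\<psi>' p z - \<psi>' p w) - (\<psi>' q z - \<psi>' q w)) \<le> \<epsilon> * norm (z - w)"
      if pq: "p \<in> ?K" "q \<in> ?K" "dist p q < \<delta>" for p q z w
    proof -
      have eq: "(\<psi>' p z - \<psi>' p w) - (\<psi>' q z - \<psi>' q w) = ((\<psi> p z - \<psi> p w) - (\<psi> q z - \<psi> q w)) +
          (\<Sum>s\<in>J. (F s p - F s q) * of_real (\<beta> s z - \<beta> s w))"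
        unfolding diff by (simp add: left_diff_distrib sum_subtractf)
      have "norm (\<Sum>s\<in>J. (F s p - F s q) * of_real (\<beta> s z - \<beta> s w)) \<le>
          real (card J) * (\<kappa> * (L / d * norm (z - w)))"
      proof (rule sum_norm_bound)
        fix s
        assume s: "s \<in> J"
        have "norm (F s p - F s q) * \<bar>\<beta> s z - \<beta> s w\<bar> \<le> \<kappa> * (L / d * norm (z - w))"
          using \<delta>2(2)[OF s pq(2,1)] \<delta>(3)[OF s] pq(3) \<beta>L'[OF s, of z w] \<kappa>
          by (intro mult_mono) (auto simp: dist_norm)
        then show "norm ((F s p - F s q) * of_real (\<beta> s z - \<beta> s w)) \<le> \<kappa> * (L / d * norm (z - w))"
          by (simp only: norm_mult norm_of_real)
      qed
      also have "real (card J) * (\<kappa> * (L / d * norm (z - w))) \<le> \<epsilon> / 2 * norm (z - w)"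
      proof -
        have "real (card J) * (\<kappa> * (L / d)) \<le> a * (\<kappa> * b)"
          using \<kappa> Ld ab by (intro mult_mono mult_nonneg_nonneg) (auto intro: less_imp_le)
        also have "\<dots> = \<epsilon> / 2"
          using ab(1,2) by (simp add: \<kappa>_def)
        finally have "real (card J) * (\<kappa> * (L / d)) * norm (z - w) \<le> \<epsilon> / 2 * norm (z - w)"
          by (rule mult_right_mono) simp
        then show ?thesis
          by (simp only: mult.assoc)
      qed
      finally have 1: "norm (\<Sum>s\<in>J. (F s p - F s q) * of_real (\<beta> s z - \<beta> s w)) \<le> \<epsilon> / 2 * norm (z - w)" .
      have 2: "norm ((\<psi> p z - \<psi> p w) - (\<psi> q z - \<psi> q w)) \<le> \<epsilon> / 2 * norm (z - w)"
        using pq \<delta>(2) by (intro \<delta>1(2)) auto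
      show ?thesis
        unfolding eq using norm_triangle_mono[OF 2 1] by simp
    qed
    then show ?thesis
      using \<delta>(1) by blast
  qed
  have "quasi_motion e P \<zeta> h \<psi>'"
    unfolding quasi_motion_def
  proof (intro conjI)
    show "\<exists>C. \<forall>p\<in>?K. \<forall>z. norm (\<psi>' p z - z) \<le> C"
      using bdd by blast
    show "\<exists>L. \<forall>p\<in>?K. \<forall>z w. norm (\<psi>' p z - \<psi>' p w) \<le> L * norm (z - w)"
      using lip by blast
    have "m / 4 > 0"
      using m(1) by simp
    then show "\<exists>m>0. \<forall>p\<in>?S. \<forall>z w. m * norm (z - w) \<le> norm (\<psi>' p z - \<psi>' p w)"
      using low by blast
    show "\<forall>\<epsilon>>0. \<exists>\<delta>>0. \<forall>p\<in>?K. \<forall>q\<in>?K. dist p q < \<delta> \<longrightarrow>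
        (\<forall>z w. norm ((\<psi>' p z - \<psi>' p w) - (\<psi>' q z - \<psi>' q w)) \<le> \<epsilon> * norm (z - w))"
      using cont' by simp
  qed (use hol base fixP track in blast)+
  then show ?thesis
    by blast
qed

text \<open>The slices of a null-homotopy are merely continuous loops, so each is replaced by a
  nearby holomorphic one. Starting from the identity, one step leads to each next slice; clearance
  and step size come from compactness of the homotopy and are the same at every stage.\<close>

lemma quasi_motion_of_null_loop:
  assumes "finite P" and e: "0 < e" "e \<le> 1" and f: "f holomorphic_on ann e" "f 1 = \<zeta>"
    and null: "null_loop (- P) (f \<circ> circlepath 0 1)"
  shows "\<exists>\<psi>. quasi_motion e P \<zeta> f \<psi>"
proof -
  let ?I = "{0..1 :: real} \<times> {0..1 :: real}"
  let ?\<gamma> = "f \<circ> circlepath 0 1"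
  have start: "pathstart ?\<gamma> = \<zeta>"
    using f(2) by (simp add: pathstart_compose)
  have "homotopic_paths (- P) (\<lambda>_. \<zeta>) ?\<gamma>"
    using null unfolding null_loop_def start by (rule homotopic_paths_sym)
  then obtain k where k: "continuous_on ?I k" "k \<in> ?I \<rightarrow> - P"
    "\<And>x. x \<in> {0..1} \<Longrightarrow> k (0, x) = \<zeta>" "\<And>x. x \<in> {0..1} \<Longrightarrow> k (1, x) = ?\<gamma> x"
    "\<And>t. t \<in> {0..1} \<Longrightarrow> k (t, 0) = \<zeta>" "\<And>t. t \<in> {0..1} \<Longrightarrow> k (t, 1) = \<zeta>"
    unfolding homotopic_paths pathstart_def pathfinish_def comp_def by blast
  have cI: "compact ?I"
    by (intro compact_Times compact_Icc)
  have "compact (k ` ?I)"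
    by (rule compact_continuous_image[OF k(1) cI])
  moreover have "closed P" "k ` ?I \<inter> P = {}"
    using assms(1) k(2) finite_imp_closed by auto
  ultimately obtain D where D: "D > 0" "\<And>x y. x \<in> k ` ?I \<Longrightarrow> y \<in> P \<Longrightarrow> D \<le> dist x y"
    using separate_compact_closed[of "k ` ?I" P] by metis
  \<comment> \<open>Halving \<open>D\<close> leaves the approximating loops the clearance
    \<open>d\<close>. A step adds two approximation errors and one change of slice, each below
    \<open>d / 12\<close>, which gives the admissible \<open>d / 4\<close>.\<close>
  define d where "d = D / 2"
  have d: "d > 0" "\<And>x z. x \<in> ?I \<Longrightarrow> z \<in> P \<Longrightarrow> 2 * d \<le> norm (z - k x)"
  proof -
    show "d > 0"
      using D(1) by (simp add: d_def)
    show "2 * d \<le> norm (z - k x)" if "x \<in> ?I" "z \<in> P" for x z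
      using D(2)[OF imageI[OF that(1)] that(2)] by (simp add: d_def dist_norm norm_minus_commute)
  qed
  have "uniformly_continuous_on ?I k"
    by (rule compact_uniformly_continuous[OF k(1) cI])
  then obtain \<delta> where \<delta>: "\<delta> > 0" "\<And>x y. x \<in> ?I \<Longrightarrow> y \<in> ?I \<Longrightarrow> dist y x < \<delta> \<Longrightarrow> dist (k y) (k x) < d / 12"
    unfolding uniformly_continuous_on_def using d(1) by (metis divide_pos_pos zero_less_numeral)
  obtain N :: nat where N: "N > 0" "inverse (real N) < \<delta>"
    using \<delta>(1) ex_inverse_of_nat_less by blast
  have frac: "real i / real N \<in> {0..1}" if "i \<le> N" for i
    using that N(1) by auto
  have "\<exists>g. i \<le> N \<longrightarrow> g holomorphic_on - {0} \<and> g 1 = \<zeta> \<and>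
      (\<forall>t\<in>{0..1}. norm (g (circlepath 0 1 t) - k (real i / real N, t)) < d / 12)" for i
  proof (cases "i \<le> N")
    case True
    let ?\<gamma>i = "\<lambda>t. k (real i / real N, t)"
    have "path ?\<gamma>i"
      unfolding path_def
      by (rule continuous_on_compose2[OF k(1)]) (use frac[OF True] in \<open>auto intro!: continuous_intros\<close>)
    moreover have "pathfinish ?\<gamma>i = pathstart ?\<gamma>i"
      using k(5,6) frac[OF True] by (simp add: pathstart_def pathfinish_def)
    ultimately obtain c where c: "continuous_on unit_circle c"
      "\<And>t. t \<in> {0..1} \<Longrightarrow> c (circlepath 0 1 t) = ?\<gamma>i t"
      using circle_function_of_loop[of ?\<gamma>i] by blast
    obtain g where g: "g holomorphic_on - {0}" "g 1 = c 1"
      "\<And>z. z \<in> unit_circle \<Longrightarrow> norm (g z - c z) < d / 12"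
      using holomorphic_approximation_on_circle[OF c(1), of "d / 12"] d(1) by auto
    have "c 1 = \<zeta>"
      using c(2)[of 0] k(5) frac[OF True] by (simp add: circlepath)
    moreover have "circlepath 0 1 t \<in> unit_circle" for t
      by (simp add: circlepath norm_mult)
    moreover have "norm (g (circlepath 0 1 t) - ?\<gamma>i t) < d / 12" if "t \<in> {0..1}" for t
      using g(3)[of "circlepath 0 1 t"] c(2)[OF that] calculation(2) by simp
    ultimately show ?thesis
      using g(1,2) by (intro exI[of _ g]) auto
  qed simp
  then obtain g where g: "\<And>i. i \<le> N \<Longrightarrow> g i holomorphic_on - {0}" "\<And>i. i \<le> N \<Longrightarrow> g i 1 = \<zeta>"
    "\<And>i t. i \<le> N \<Longrightarrow> t \<in> {0..1} \<Longrightarrow> norm (g i (circlepath 0 1 t) - k (real i / real N, t)) < d / 12"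
    by metis
  have circ: "\<exists>t\<in>{0..1}. p = circlepath 0 1 t" if "p \<in> unit_circle" for p
    using that path_image_circlepath[of 0 1] by (auto simp: path_image_def)
  have ghol: "g i holomorphic_on ann e" if "i \<le> N" for i
    using g(1)[OF that] zero_notin_ann[OF e(2)] by (auto intro: holomorphic_on_subset)
  have far: "d \<le> norm (z - g i p)" if i: "i \<le> N" and p: "p \<in> unit_circle" and z: "z \<in> P" for i p z
  proof -
    obtain t where t: "t \<in> {0..1}" "p = circlepath 0 1 t"
      using circ[OF p] by blast
    have "2 * d \<le> norm (z - k (real i / real N, t))"
      using frac[OF i] t(1) z by (intro d(2)) auto
    moreover have "norm (z - k (real i / real N, t)) \<le> norm (z - g i p) + norm (g i p - k (real i / real N, t))"
      using norm_triangle_ineq[of "z - g i p" "g i p - k (real i / real N, t)"] by simp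
    ultimately show ?thesis
      using g(3)[OF i t(1)] t(2) d(1) by simp
  qed
  have step: "norm (g (Suc i) p - g i p) \<le> d / 4" if i: "Suc i \<le> N" and p: "p \<in> unit_circle" for i p
  proof -
    obtain t where t: "t \<in> {0..1}" "p = circlepath 0 1 t"
      using circ[OF p] by blast
    let ?a = "k (real (Suc i) / real N, t)" and ?b = "k (real i / real N, t)"
    have "dist (real (Suc i) / real N, t) (real i / real N, t) = dist (real (Suc i) / real N) (real i / real N)"
      by (simp add: dist_Pair_Pair)
    also have "\<dots> = inverse (real N)"
      by (simp add: dist_real_def diff_divide_distrib[symmetric] inverse_eq_divide)
    finally have "dist ?a ?b < d / 12"
      using frac[of i] frac[of "Suc i"] i t(1) N(2) by (intro \<delta>(2)) auto
    moreover have eq: "g (Suc i) p - g i p = (g (Suc i) p - ?a) + (?a - ?b) - (g i p - ?b)"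
      by simp
    have "norm (g (Suc i) p - g i p) \<le> norm (g (Suc i) p - ?a) + norm (?a - ?b) + norm (g i p - ?b)"
      unfolding eq using norm_triangle_ineq4[of "(g (Suc i) p - ?a) + (?a - ?b)" "g i p - ?b"]
        norm_triangle_ineq[of "g (Suc i) p - ?a" "?a - ?b"] by linarith
    ultimately show ?thesis
      using g(3)[of "Suc i" t] g(3)[of i t] i t by (simp add: dist_norm)
  qed
  have qm: "\<exists>\<psi>. quasi_motion e P \<zeta> (g i) \<psi>" if "i \<le> N" for i
    using that
  proof (induction i)
    case 0
    show ?case
    proof (rule quasi_motion_step[OF quasi_motion_id e d(1)])
      fix p z :: complex
      assume "p \<in> unit_circle" "z \<in> P"
      then show "d \<le> norm (z - \<zeta>)"
        using d(2)[of "(0, 0)" z] k(3)[of 0] d(1) by auto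
    next
      fix p :: complex
      assume "p \<in> unit_circle"
      then obtain t where t: "t \<in> {0..1}" "p = circlepath 0 1 t"
        using circ by blast
      then show "norm (g 0 p - \<zeta>) \<le> d / 4"
        using g(3)[of 0 t] k(3)[of t] d(1) by auto
    qed (use g(2) ghol in auto)
  next
    case (Suc i)
    then obtain \<psi> where \<psi>: "quasi_motion e P \<zeta> (g i) \<psi>"
      by auto
    show ?case
      by (rule quasi_motion_step[OF \<psi> e d(1)]) (use Suc far step ghol g(2) in auto)
  qed
  then obtain \<psi> where \<psi>: "quasi_motion e P \<zeta> (g N) \<psi>"
    by blast
  \<comment> \<open>The last slice only approximates \<open>f\<close>; one further step lands on
    \<open>f\<close> itself.\<close>
  show ?thesis
  proof (rule quasi_motion_step[OF \<psi> e d(1)])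
    fix p :: complex
    assume "p \<in> unit_circle"
    then obtain t where t: "t \<in> {0..1}" "p = circlepath 0 1 t"
      using circ by blast
    have "norm (f p - g N p) = norm (g N p - k (real N / real N, t))"
      using t k(4) N(1) by (simp add: norm_minus_commute)
    also have "\<dots> \<le> d / 4"
      using g(3)[of N t] t d(1) by simp
    finally show "norm (f p - g N p) \<le> d / 4" .
  qed (use far ghol f in auto)
qed

text \<open>Bounded displacement and joint continuity are what the winding number argument needs:
  they let a point be moved far away while its traced loop stays near it.\<close>

definition plane_motion ::
  "real \<Rightarrow> complex set \<Rightarrow> complex \<Rightarrow> (complex \<Rightarrow> complex) \<Rightarrow> (complex \<Rightarrow> complex \<Rightarrow> complex) \<Rightarrow> bool"
where
  "plane_motion e P \<zeta> f \<psi> \<longleftrightarrow>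
     (\<forall>z. (\<lambda>p. \<psi> p z) holomorphic_on ann e) \<and>
     (\<forall>z. \<psi> 1 z = z) \<and>
     (\<forall>p\<in>ann e. inj (\<psi> p)) \<and>
     (\<forall>p\<in>ann e. \<forall>z\<in>P. \<psi> p z = z) \<and>
     (\<forall>p\<in>ann e. \<psi> p \<zeta> = f p) \<and>
     (\<exists>C. \<forall>p\<in>ann e. \<forall>z. norm (\<psi> p z - z) \<le> C) \<and>
     continuous_on (ann e \<times> UNIV) (\<lambda>(p, z). \<psi> p z)"

lemma plane_motion_mono:
  assumes "plane_motion e P \<zeta> f \<psi>" "e' \<le> e"
  shows "plane_motion e' P \<zeta> f \<psi>"
proof -
  have sub: "ann e' \<subseteq> ann e"
    by (rule ann_mono[OF assms(2)])
  have "ann e' \<times> (UNIV :: complex set) \<subseteq> ann e \<times> UNIV"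
    using sub by auto
  then have "continuous_on (ann e' \<times> UNIV) (\<lambda>(p, z). \<psi> p z)"
    using assms(1) continuous_on_subset unfolding plane_motion_def by blast
  moreover have "\<forall>z. (\<lambda>p. \<psi> p z) holomorphic_on ann e'"
    using assms(1) holomorphic_on_subset[OF _ sub] unfolding plane_motion_def by blast
  moreover have "\<exists>C. \<forall>p\<in>ann e. \<forall>z. norm (\<psi> p z - z) \<le> C"
    using assms(1) unfolding plane_motion_def by (elim conjE)
  then have "\<exists>C. \<forall>p\<in>ann e'. \<forall>z. norm (\<psi> p z - z) \<le> C"
    using sub by blast
  ultimately show ?thesis
    using assms(1) sub unfolding plane_motion_def by (simp add: subset_iff)
qed

text \<open>Over the circle distances shrink at most by the factor \<open>m\<close>. A parameter
  within \<open>\<delta>\<close> of its radial projection \<open>sgn p\<close> changes increments by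
  at most \<open>m / 2\<close> relative to \<open>norm (z - w)\<close>, so the factor
  \<open>m / 2\<close> survives for all \<open>z\<close> and \<open>w\<close>
  simultaneously.\<close>

lemma motion_of_null_loop:
  assumes "finite P" and e: "0 < e" "e \<le> 1" and f: "f holomorphic_on ann e" "f 1 = \<zeta>"
    and null: "null_loop (- P) (f \<circ> circlepath 0 1)"
  obtains e' \<psi> where "0 < e'" "e' \<le> e" "plane_motion e' P \<zeta> f \<psi>"
proof -
  obtain \<psi> where qm: "quasi_motion e P \<zeta> f \<psi>"
    using quasi_motion_of_null_loop[OF assms] by blast
  let ?S = "unit_circle" and ?K = "cann (e/2)"
  have q: "\<And>z. (\<lambda>p. \<psi> p z) holomorphic_on ann e" "\<And>z. \<psi> 1 z = z"
    "\<And>p z. p \<in> ann e \<Longrightarrow> z \<in> P \<Longrightarrow> \<psi> p z = z" "\<And>p. p \<in> ann e \<Longrightarrow> \<psi> p \<zeta> = f p"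
    using qm unfolding quasi_motion_def by blast+
  have "\<exists>C. \<forall>p\<in>?K. \<forall>z. norm (\<psi> p z - z) \<le> C"
    using qm unfolding quasi_motion_def by (elim conjE)
  then obtain C where C: "\<And>p z. p \<in> ?K \<Longrightarrow> norm (\<psi> p z - z) \<le> C"
    by blast
  have "\<exists>L. \<forall>p\<in>?K. \<forall>z w. norm (\<psi> p z - \<psi> p w) \<le> L * norm (z - w)"
    using qm unfolding quasi_motion_def by (elim conjE)
  then obtain L where L: "\<And>p z w. p \<in> ?K \<Longrightarrow> norm (\<psi> p z - \<psi> p w) \<le> L * norm (z - w)"
    by blast
  have "\<exists>m>0. \<forall>p\<in>?S. \<forall>z w. m * norm (z - w) \<le> norm (\<psi> p z - \<psi> p w)"
    using qm unfolding quasi_motion_def by (elim conjE)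
  then obtain m where m: "m > 0" "\<And>p z w. p \<in> ?S \<Longrightarrow> m * norm (z - w) \<le> norm (\<psi> p z - \<psi> p w)"
    by blast
  have "\<exists>\<delta>>0. \<forall>p\<in>?K. \<forall>q\<in>?K. dist p q < \<delta> \<longrightarrow>
        (\<forall>z w. norm ((\<psi> p z - \<psi> p w) - (\<psi> q z - \<psi> q w)) \<le> \<epsilon> * norm (z - w))" if "\<epsilon> > 0" for \<epsilon>
    using qm that unfolding quasi_motion_def by (elim conjE) simp
  from this[of "m / 2"] m(1) obtain \<delta> where \<delta>: "\<delta> > 0" "\<And>p q z w. p \<in> ?K \<Longrightarrow> q \<in> ?K \<Longrightarrow> dist p q < \<delta> \<Longrightarrow>
        norm ((\<psi> p z - \<psi> p w) - (\<psi> q z - \<psi> q w)) \<le> m / 2 * norm (z - w)"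
    by (auto simp: Ball_def)
  define e' where "e' = min (e / 2) \<delta>"
  have e': "0 < e'" "e' \<le> e / 2" "e' \<le> \<delta>"
    using e \<delta>(1) by (auto simp: e'_def)
  have sub: "ann e' \<subseteq> ann e" "ann e' \<subseteq> ?K"
    using e e' by (auto simp: ann_def cann_def)
  have low: "m / 2 * norm (z - w) \<le> norm (\<psi> p z - \<psi> p w)" if p: "p \<in> ann e'" for p z w
  proof -
    have "p \<noteq> 0"
      using p e e' zero_notin_ann[of e'] by auto
    have "dist p (sgn p) = \<bar>norm p - 1\<bar>"
      by (rule dist_sgn[OF \<open>p \<noteq> 0\<close>])
    also have "\<dots> < \<delta>"
      using p e' by (auto simp: ann_def)
    finally have d: "dist p (sgn p) < \<delta>" .
    have "sgn p \<in> ?S"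
      using \<open>p \<noteq> 0\<close> by (simp add: norm_sgn)
    moreover from this have "sgn p \<in> ?K"
      using e by (auto simp: cann_def)
    ultimately have "norm ((\<psi> p z - \<psi> p w) - (\<psi> (sgn p) z - \<psi> (sgn p) w)) \<le> m / 2 * norm (z - w)"
      "m * norm (z - w) \<le> norm (\<psi> (sgn p) z - \<psi> (sgn p) w)"
      using \<delta>(2)[OF subsetD[OF sub(2) p] _ d] m(2) by auto
    then show ?thesis
      using norm_triangle_ineq2[of "\<psi> (sgn p) z - \<psi> (sgn p) w" "\<psi> p z - \<psi> p w"]
        norm_minus_commute[of "\<psi> (sgn p) z - \<psi> (sgn p) w" "\<psi> p z - \<psi> p w"] by simp
  qed
  have "plane_motion e' P \<zeta> f \<psi>"
    unfolding plane_motion_def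
  proof (intro conjI allI ballI)
    show "(\<lambda>p. \<psi> p z) holomorphic_on ann e'" for z
      using q(1) sub(1) holomorphic_on_subset by blast
    show "inj (\<psi> p)" if "p \<in> ann e'" for p
    proof (rule injI)
      fix z w
      assume "\<psi> p z = \<psi> p w"
      then have "m / 2 * norm (z - w) \<le> 0"
        using low[OF that, of z w] by simp
      then show "z = w"
        using m(1) by (simp add: mult_le_0_iff)
    qed
    \<comment> \<open>Continuity in \<open>p\<close> for fixed \<open>z\<close>, together with a
      Lipschitz bound in \<open>z\<close> uniform in \<open>p\<close>, gives joint
      continuity.\<close>
    show "continuous_on (ann e' \<times> UNIV) (\<lambda>(p, z). \<psi> p z)"
      unfolding continuous_on_def
    proof clarify
      fix p z :: complex
      assume p: "p \<in> ann e'"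
      let ?F = "at (p, z) within ann e' \<times> UNIV"
      have ev: "\<forall>\<^sub>F x in ?F. fst x \<in> ann e'"
        by (auto simp: eventually_at_filter intro!: always_eventually)
      have "((\<lambda>x. \<psi> (fst x) z) \<longlongrightarrow> \<psi> p z) ?F"
      proof -
        have "continuous_on (ann e') (\<lambda>p. \<psi> p z)"
          using q(1) sub(1) holomorphic_on_imp_continuous_on holomorphic_on_subset by blast
        then have "continuous_on (ann e' \<times> UNIV) (\<lambda>x :: complex \<times> complex. \<psi> (fst x) z)"
          by (rule continuous_on_compose2) (auto intro: continuous_intros)
        then show ?thesis
          using p unfolding continuous_on_def by force
      qed
      moreover have "((\<lambda>x. \<psi> (fst x) (snd x) - \<psi> (fst x) z) \<longlongrightarrow> 0) ?F"
      proof (rule Lim_null_comparison)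
        show "\<forall>\<^sub>F x in ?F. norm (\<psi> (fst x) (snd x) - \<psi> (fst x) z) \<le> L * norm (snd x - z)"
          using ev by eventually_elim (use L sub(2) in auto)
        have "((\<lambda>x :: complex \<times> complex. L * norm (snd x - z)) \<longlongrightarrow> L * norm (snd (p, z) - z)) ?F"
          by (intro tendsto_intros)
        then show "((\<lambda>x :: complex \<times> complex. L * norm (snd x - z)) \<longlongrightarrow> 0) ?F"
          by simp
      qed
      ultimately have "((\<lambda>x. \<psi> (fst x) z + (\<psi> (fst x) (snd x) - \<psi> (fst x) z)) \<longlongrightarrow> \<psi> p z + 0) ?F"
        by (rule tendsto_add)
      then show "((\<lambda>(p, z). \<psi> p z) \<longlongrightarrow> \<psi> p z) ?F"
        by (simp add: case_prod_unfold)
    qed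
    show "\<exists>C. \<forall>p\<in>ann e'. \<forall>z. norm (\<psi> p z - z) \<le> C"
      using C sub(2) by blast
  qed (use q sub in blast)+
  then show ?thesis
    using that[of e' \<psi>] e e' by simp
qed

section \<open>Motions of the whole plane have trivial monodromy\<close>

lemma Schottky_disc:
  assumes "f holomorphic_on cball a r" "r > 0" "norm (f a) \<le> R"
    and "\<And>z. z \<in> cball a r \<Longrightarrow> f z \<noteq> 0 \<and> f z \<noteq> 1" "norm (z - a) \<le> r / 2"
  shows "norm (f z) \<le> exp (pi * exp (pi * (14 + 2 * R)))"
proof -
  define h where "h = (\<lambda>u. f (a + of_real r * u))"
  have sub: "a + of_real r * u \<in> cball a r" if "u \<in> cball 0 1" for u
    using that assms(2) by (simp add: dist_norm norm_mult mult_left_le)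
  have "h holomorphic_on cball 0 1"
    unfolding h_def
    by (rule holomorphic_on_compose_gen[OF _ assms(1), unfolded o_def])
       (use sub in \<open>auto intro!: holomorphic_intros\<close>)
  moreover have "norm ((z - a) / of_real r) \<le> 1 / 2"
    using assms(2,5) by (simp add: norm_divide field_simps)
  ultimately have bd: "norm (h ((z - a) / of_real r)) \<le> exp (pi * exp (pi * (2 + 2 * R + 12 * (1/2) / (1 - 1/2))))"
    using assms(3,4) sub by (intro Schottky) (auto simp: h_def)
  \<comment> \<open>Half the radius is allowed, so the exponent \<open>12 * t / (1 - t)\<close> is
    taken at \<open>t = 1/2\<close>.\<close>
  have e: "2 + 2 * R + 12 * (1/2) / (1 - 1/2) = 14 + 2 * R"
    by simp
  have "h ((z - a) / of_real r) = f z"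
    using assms(2) by (simp add: h_def)
  then show ?thesis
    using bd unfolding e by (simp only:)
qed

lemma norm_exp_i_diff: "norm (exp (\<i> * of_real s) - exp (\<i> * of_real t)) \<le> \<bar>s - t\<bar>"
proof -
  have "exp (\<i> * of_real s) = exp (\<i> * of_real t + \<i> * of_real (s - t))"
    by (simp add: algebra_simps)
  then have "exp (\<i> * of_real s) = exp (\<i> * of_real t) * exp (\<i> * of_real (s - t))"
    by (simp only: exp_add)
  then have "norm (exp (\<i> * of_real s) - exp (\<i> * of_real t)) =
      norm (exp (\<i> * of_real t) * (exp (\<i> * of_real (s - t)) - 1))"
    by (simp only: right_diff_distrib mult_1_right)
  also have "\<dots> = 2 * \<bar>sin ((s - t) / 2)\<bar>"
    by (simp only: norm_mult dist_exp_i_1 norm_exp_i_times mult_1_left)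
  also have "\<dots> \<le> 2 * \<bar>(s - t) / 2\<bar>"
    by (intro mult_left_mono abs_sin_x_le_abs_x) auto
  finally show ?thesis
    by simp
qed

text \<open>A chain of discs along the circle transports a bound from \<open>p\<close> to 1 by
  iterating Schottky's theorem. The length of the chain depends on the width of the annulus only, so
  the bound is uniform over all functions that omit 0 and 1.\<close>

lemma bound_along_circle:
  assumes e: "0 < e" "e \<le> 1"
  obtains N where "\<And>f p R. \<lbrakk>f holomorphic_on ann e; \<And>z. z \<in> ann e \<Longrightarrow> f z \<noteq> 0 \<and> f z \<noteq> 1;
      p \<in> unit_circle; norm (f p) \<le> R\<rbrakk> \<Longrightarrow>
      norm (f 1) \<le> ((\<lambda>R. exp (pi * exp (pi * (14 + 2 * R)))) ^^ Suc N) R"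
proof -
  define T where "T = (\<lambda>R. exp (pi * exp (pi * (14 + 2 * R))))"
  \<comment> \<open>Arcs of length at most \<open>e / 4\<close>: half the radius of the discs of
    radius \<open>e / 2\<close> that fit into the annulus.\<close>
  obtain N :: nat where N: "8 * pi / e < real N"
    using reals_Archimedean2 by blast
  have N0: "real N > 0"
    using N e pi_gt_zero by (smt (verit) divide_pos_pos)
  have "norm (f 1) \<le> (T ^^ Suc N) R"
    if f: "f holomorphic_on ann e" "\<And>z. z \<in> ann e \<Longrightarrow> f z \<noteq> 0 \<and> f z \<noteq> 1"
      and p: "p \<in> unit_circle" "norm (f p) \<le> R" for f p R
  proof -
    have step: "norm (f q) \<le> T B" if "norm (f b) \<le> B" "b \<in> unit_circle" "norm (q - b) \<le> e / 4" for q b B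
    proof -
      have sub: "cball b (e/2) \<subseteq> ann e"
      proof
        fix u
        assume "u \<in> cball b (e/2)"
        then show "u \<in> ann e"
          using that(2) e(1) norm_triangle_ineq3[of u b] by (auto simp: ann_def dist_norm norm_minus_commute)
      qed
      show ?thesis
        unfolding T_def
        by (rule Schottky_disc[of f b "e/2"]) (use f sub that e in \<open>auto intro: holomorphic_on_subset\<close>)
    qed
    define \<theta> where "\<theta> = Arg2pi p"
    have \<theta>: "0 \<le> \<theta>" "\<theta> \<le> 2 * pi" "exp (\<i> * of_real \<theta>) = p"
      using Arg2pi[of p] complex_norm_eq_1_exp[of p] p(1) by (auto simp: \<theta>_def)
    define q where "q = (\<lambda>k. exp (\<i> * of_real (\<theta> * (1 - real k / real N))))"
    have qd: "norm (q (Suc k) - q k) \<le> e / 4" for k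
    proof -
      have "norm (q (Suc k) - q k) \<le> \<bar>\<theta> * (1 - real (Suc k) / real N) - \<theta> * (1 - real k / real N)\<bar>"
        unfolding q_def by (rule norm_exp_i_diff)
      also have "\<dots> = \<theta> / real N"
        using \<theta>(1) N0 by (simp add: field_simps abs_if)
      also have "\<dots> \<le> 2 * pi / real N"
        using \<theta>(2) N0 by (intro divide_right_mono) auto
      also have "\<dots> \<le> e / 4"
        using N N0 e(1) by (simp add: field_simps)
      finally show ?thesis .
    qed
    have qS: "q k \<in> unit_circle" for k
      by (simp add: q_def)
    have "norm (f (q k)) \<le> (T ^^ k) R" for k
    proof (induction k)
      case 0
      then show ?case
        using p(2) \<theta>(3) by (simp add: q_def)
    next
      case (Suc k)
      then show ?case
        using step[OF Suc qS qd] by simp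
    qed
    then have "norm (f (q N)) \<le> (T ^^ N) R"
      by blast
    moreover have "q N = 1"
      using N0 by (simp add: q_def)
    \<comment> \<open>One idle step at 1. The iterate then ends with an exponential, so that the
      bound is visibly positive when it is used as a denominator.\<close>
    ultimately have "norm (f 1) \<le> T ((T ^^ N) R)"
      using step[of 1 "(T ^^ N) R" 1] e(1) by simp
    then show ?thesis
      by simp
  qed
  then show ?thesis
    using that[of N] unfolding T_def by blast
qed

text \<open>Apply the transported bound to \<open>1 / G\<close>, which omits 0 and 1 as well: if
  \<open>G\<close> were not small at \<open>p\<close>, then \<open>1 / G\<close> would be bounded at
  1, contrary to \<open>G\<close> being tiny there.\<close>

lemma uniformly_small_on_circle:
  assumes e: "0 < e" "e \<le> 1" and "\<epsilon> > 0"
  obtains \<delta> where "\<delta> > 0" "\<And>G p. \<lbrakk>G holomorphic_on ann e; \<And>z. z \<in> ann e \<Longrightarrow> G z \<noteq> 0 \<and> G z \<noteq> 1;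
      norm (G 1) < \<delta>; p \<in> unit_circle\<rbrakk> \<Longrightarrow> norm (G p) < \<epsilon>"
proof -
  obtain N where N: "\<And>f p R. \<lbrakk>f holomorphic_on ann e; \<And>z. z \<in> ann e \<Longrightarrow> f z \<noteq> 0 \<and> f z \<noteq> 1;
      p \<in> unit_circle; norm (f p) \<le> R\<rbrakk> \<Longrightarrow>
      norm (f 1) \<le> ((\<lambda>R. exp (pi * exp (pi * (14 + 2 * R)))) ^^ Suc N) R"
    using bound_along_circle[OF e] by blast
  define B where "B = ((\<lambda>R. exp (pi * exp (pi * (14 + 2 * R)))) ^^ Suc N) (1 / \<epsilon>)"
  have "B > 0"
    by (simp add: B_def)
  show ?thesis
  proof (rule that[of "1 / B"])
    show "1 / B > 0"
      using \<open>B > 0\<close> by simp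
    fix G :: "complex \<Rightarrow> complex" and p :: complex
    assume G: "G holomorphic_on ann e" "\<And>z. z \<in> ann e \<Longrightarrow> G z \<noteq> 0 \<and> G z \<noteq> 1"
      "norm (G 1) < 1 / B" and p: "p \<in> unit_circle"
    show "norm (G p) < \<epsilon>"
    proof (rule ccontr)
      assume "\<not> norm (G p) < \<epsilon>"
      then have "norm (1 / G p) \<le> 1 / \<epsilon>"
        using assms(3) by (simp add: norm_divide frac_le)
      then have "norm (1 / G 1) \<le> B"
        unfolding B_def
        by (intro N[of "\<lambda>z. 1 / G z"]) (use G p in \<open>auto intro!: holomorphic_intros\<close>)
      moreover have "G 1 \<noteq> 0"
        using G(2)[of 1] e by (auto simp: ann_def)
      ultimately show False
        using G(3) \<open>B > 0\<close> by (simp add: norm_divide field_simps)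
    qed
  qed
qed

text \<open>An extension to the whole sphere makes all loops traced out by points off \<open>A\<close> homotopic;
  those traced out by points close to \<open>0\<close> stay in a small punctured disc.\<close>

lemma null_loop_of_motion:
  fixes g :: "complex \<Rightarrow> complex \<Rightarrow> complex"
  assumes e: "0 < e" "e \<le> 1" and A: "finite A" "0 \<in> A" "1 \<in> A" "\<zeta> \<notin> A"
    and hol: "\<And>w. g w holomorphic_on ann e" and base: "\<And>w. g w 1 = w"
    and inj: "\<And>w w' p. w \<noteq> w' \<Longrightarrow> p \<in> ann e \<Longrightarrow> g w p \<noteq> g w' p"
    and fixA: "\<And>a p. a \<in> A \<Longrightarrow> p \<in> ann e \<Longrightarrow> g a p = a"
    and wn: "winding_number (g \<zeta> \<circ> circlepath 0 1) 0 = 0"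
  shows "null_loop (- A) (g \<zeta> \<circ> circlepath 0 1)"
proof -
  define \<gamma> where "\<gamma> = (\<lambda>w. g w \<circ> circlepath 0 1)"
  have S: "unit_circle \<subseteq> ann e"
    using sphere_subset_ann[OF e(1)] .
  have circ: "circlepath 0 1 t \<in> unit_circle" for t
    by (simp add: circlepath norm_mult)
  have avoid: "g w p \<notin> A" if "w \<notin> A" "p \<in> ann e" for w p
    using inj[of w "g w p" p] fixA[of "g w p" p] that by metis
  have avoid01: "g w p \<noteq> 0 \<and> g w p \<noteq> 1" if "w \<notin> A" "p \<in> ann e" for w p
    using avoid[OF that] A by auto
  have contS: "continuous_on unit_circle (g w)" for w
    using hol S holomorphic_on_imp_continuous_on continuous_on_subset by blast
  have \<gamma>: "path (\<gamma> w)" "pathfinish (\<gamma> w) = pathstart (\<gamma> w)" for w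
    unfolding \<gamma>_def using contS[of w]
    by (auto intro!: path_continuous_image simp: pathfinish_compose pathstart_compose)
  have \<gamma>A: "path_image (\<gamma> w) \<subseteq> - A" if "w \<notin> A" for w
    using avoid[OF that subsetD[OF S circ]] by (auto simp: \<gamma>_def path_image_def)
  have loc: "\<exists>T. openin (top_of_set (- A)) T \<and> w0 \<in> T \<and> (\<forall>w\<in>T. homotopic_loops (- A) (\<gamma> w0) (\<gamma> w))"
    if w0: "w0 \<in> - A" for w0
  proof -
    have w0': "w0 \<notin> A" "w0 \<noteq> 0"
      using w0 A(2) by auto
    have cK: "compact (g w0 ` unit_circle)"
      by (rule compact_continuous_image[OF contS compact_sphere])
    moreover have "closed A" "g w0 ` unit_circle \<inter> A = {}"
      using A(1) avoid[OF w0'(1)] S by (auto simp: finite_imp_closed)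
    ultimately obtain d where d: "d > 0" "\<And>x y. x \<in> g w0 ` unit_circle \<Longrightarrow> y \<in> A \<Longrightarrow> d \<le> dist x y"
      using separate_compact_closed[of "g w0 ` unit_circle" A] by metis
    obtain M where M: "\<And>p. p \<in> unit_circle \<Longrightarrow> norm (g w0 p) \<le> M"
      using compact_imp_bounded[OF cK] unfolding bounded_iff by blast
    have M0: "M \<ge> 0"
      using order_trans[OF norm_ge_zero M[of 1]] by simp
    define \<epsilon> where "\<epsilon> = d / (M + 1)"
    have "\<epsilon> > 0"
      using d(1) M0 by (simp add: \<epsilon>_def)
    then obtain \<delta> where \<delta>: "\<delta> > 0" "\<And>G p. \<lbrakk>G holomorphic_on ann e; \<And>z. z \<in> ann e \<Longrightarrow> G z \<noteq> 0 \<and> G z \<noteq> 1;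
      norm (G 1) < \<delta>; p \<in> unit_circle\<rbrakk> \<Longrightarrow> norm (G p) < \<epsilon>"
      using uniformly_small_on_circle[OF e] by metis
    \<comment> \<open>This is where continuity in \<open>w\<close> comes from.
      \<open>1 - g w p / g w0 p\<close> omits 0 by injectivity and 1 because \<open>g w\<close>
      avoids the puncture 0, so smallness at the base point spreads over the circle. The choice of
      \<open>\<epsilon>\<close> converts this relative bound into the absolute bound
      \<open>d\<close>.\<close>
    have near: "norm (g w p - g w0 p) < d" if w: "w \<notin> A" "norm (1 - w / w0) < \<delta>" and p: "p \<in> unit_circle" for w p
    proof (cases "w = w0")
      case False
      have "norm (1 - g w p / g w0 p) < \<epsilon>"
      proof (rule \<delta>(2)[OF _ _ _ p])
        show "(\<lambda>p. 1 - g w p / g w0 p) holomorphic_on ann e"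
          using hol avoid01[OF w0'(1)] by (intro holomorphic_intros) auto
        show "1 - g w z / g w0 z \<noteq> 0 \<and> 1 - g w z / g w0 z \<noteq> 1" if "z \<in> ann e" for z
          using avoid01[OF w0'(1) that] avoid01[OF w(1) that] inj[OF False that] by auto
        show "norm (1 - g w 1 / g w0 1) < \<delta>"
          using w(2) by (simp add: base)
      qed
      moreover have nz: "g w0 p \<noteq> 0"
        using avoid01[OF w0'(1)] p S by blast
      moreover have "g w p - g w0 p = - ((1 - g w p / g w0 p) * g w0 p)"
        using nz by (simp add: field_simps)
      then have "norm (g w p - g w0 p) = norm (1 - g w p / g w0 p) * norm (g w0 p)"
        by (simp add: norm_mult)
      moreover have "norm (g w0 p) < M + 1"
        using M[OF p] by simp
      ultimately have "norm (g w p - g w0 p) < \<epsilon> * (M + 1)"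
        by (simp only:) (intro mult_strict_mono, use \<open>\<epsilon> > 0\<close> M0 in auto)
      then show ?thesis
        using M0 by (simp add: \<epsilon>_def)
    qed (use d in auto)
    define T where "T = - A \<inter> {w. norm (1 - w / w0) < \<delta>}"
    have "open {w. norm (1 - w / w0) < \<delta>}"
      using w0'(2) by (intro open_Collect_less continuous_intros) auto
    then have "openin (top_of_set (- A)) T"
      unfolding T_def by (simp add: openin_open_Int)
    moreover have "w0 \<in> T"
      using w0' \<delta>(1) by (simp add: T_def)
    moreover have "homotopic_loops (- A) (\<gamma> w0) (\<gamma> w)" if "w \<in> T" for w
    proof (rule homotopic_loops_nearby_explicit[OF \<gamma>(1) \<gamma>(1) \<gamma>(2) \<gamma>(2)])
      fix t :: real and x
      assume "t \<in> {0..1}" "x \<notin> - A"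
      then have "d \<le> norm (\<gamma> w0 t - x)"
        using d(2)[of "\<gamma> w0 t" x] circ by (auto simp: \<gamma>_def dist_norm)
      moreover have "norm (\<gamma> w t - \<gamma> w0 t) < d"
        using near[of w "circlepath 0 1 t"] that circ by (simp add: T_def \<gamma>_def)
      ultimately show "norm (\<gamma> w t - \<gamma> w0 t) < norm (\<gamma> w0 t - x)"
        by linarith
    qed
    ultimately show ?thesis
      by blast
  qed
  have conn: "connected (- A)"
    by (rule path_connected_imp_connected[OF path_connected_complement_countable])
       (auto simp: A(1) countable_finite)
  \<comment> \<open>The free homotopy class is locally constant in \<open>w\<close>, and the
    complement of \<open>A\<close> is connected.\<close>
  have all: "homotopic_loops (- A) (\<gamma> \<zeta>) (\<gamma> w)" if "w \<notin> A" for w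
    by (rule connected_equivalence_relation[OF conn, of \<zeta> w "\<lambda>a b. homotopic_loops (- A) (\<gamma> a) (\<gamma> b)"])
       (use that A(4) loc homotopic_loops_sym homotopic_loops_trans in blast)+
  obtain r where r: "r > 0" "\<And>x. x \<in> A \<Longrightarrow> x \<noteq> 0 \<Longrightarrow> r \<le> dist 0 x"
    using finite_set_avoid[OF A(1)] by metis
  obtain \<delta> where \<delta>: "\<delta> > 0" "\<And>G p. \<lbrakk>G holomorphic_on ann e; \<And>z. z \<in> ann e \<Longrightarrow> G z \<noteq> 0 \<and> G z \<noteq> 1;
      norm (G 1) < \<delta>; p \<in> unit_circle\<rbrakk> \<Longrightarrow> norm (G p) < r"
    using uniformly_small_on_circle[OF e r(1)] by metis
  define w where "w = complex_of_real (min r \<delta> / 2)"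
  have w: "norm w < \<delta>" "norm w < r" "w \<noteq> 0"
    using r(1) \<delta>(1) by (auto simp: w_def)
  then have wA: "w \<notin> A"
    using r(2)[of w] by auto
  have small: "norm (\<gamma> w t) < r" for t
    using \<delta>(2)[of "g w" "circlepath 0 1 t"] hol avoid01[OF wA] w(1) base circ by (simp add: \<gamma>_def)
  have hom: "homotopic_loops (- A) (\<gamma> \<zeta>) (\<gamma> w)"
    using all[OF wA] .
  have "homotopic_loops (- {0}) (\<gamma> \<zeta>) (\<gamma> w)"
    using hom by (rule homotopic_loops_subset) (use A(2) in auto)
  then have wn0: "winding_number (\<gamma> w) 0 = 0"
    using winding_number_homotopic_loops wn by (metis \<gamma>_def)
  have "0 \<notin> path_image (\<gamma> w)"
    using \<gamma>A[OF wA] A(2) by auto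
  moreover have "pathstart (\<gamma> w) = w"
    by (simp add: \<gamma>_def pathstart_compose base)
  then have "exp (Ln w) = pathstart (\<gamma> w)"
    using w(3) by simp
  ultimately obtain U where U: "path U" "pathstart U = Ln w"
    "\<And>t. t \<in> {0..1} \<Longrightarrow> exp (U t) = \<gamma> w t"
    "pathfinish U = Ln w + 2 * of_real pi * \<i> * winding_number (\<gamma> w) 0"
    by (rule log_lift[OF \<gamma>(1)]) (rule that)
  \<comment> \<open>The punctured disc around 0 is not simply connected, but winding number 0 closes
    the logarithm up, and the half-plane that covers the punctured disc is convex.\<close>
  have "null_loop {u. Re u < ln r} U"
  proof (rule null_loop_convex)
    show "path_image U \<subseteq> {u. Re u < ln r}"
    proof (clarsimp simp: path_image_def)
      fix t :: real
      assume "0 \<le> t" "t \<le> 1"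
      then have "exp (Re (U t)) < r"
        using small[of t] U(3)[of t] by (metis atLeastAtMost_iff norm_exp_eq_Re)
      then show "Re (U t) < ln r"
        using r(1) exp_less_cancel_iff[of "Re (U t)" "ln r"] by simp
    qed
  qed (use U wn0 in \<open>simp_all add: convex_halfspace_Re_lt\<close>)
  then have "null_loop (- A) (exp \<circ> U)"
  proof (rule null_loop_image)
    show "exp ` {u. Re u < ln r} \<subseteq> - A"
    proof clarsimp
      fix u
      assume u: "Re u < ln r" "exp u \<in> A"
      then have "r \<le> norm (exp u)"
        using r(2)[of "exp u"] by simp
      moreover have "exp (Re u) < exp (ln r)"
        using u(1) by simp
      ultimately show False
        using r(1) by simp
    qed
  qed (auto intro: continuous_intros)
  moreover have "homotopic_loops (- A) (exp \<circ> U) (\<gamma> w)"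
    using null_loopD[OF calculation] U(3) by (intro homotopic_loops_eq) auto
  ultimately have "null_loop (- A) (\<gamma> w)"
    by (rule null_loop_homotopic)
  then show ?thesis
    using null_loop_homotopic[OF _ homotopic_loops_sym[OF hom]] by (simp add: \<gamma>_def)
qed

section \<open>Plane domains as Riemann surfaces\<close>

definition planar :: "complex set \<Rightarrow> complex surface" where
  "planar X = \<lparr>surface_top = top_of_set X, atlas = {(X, id)}\<rparr>"

lemma surface_top_planar [simp]: "surface_top (planar X) = top_of_set X"
  and atlas_planar [simp]: "atlas (planar X) = {(X, id)}"
  by (simp_all add: planar_def)

lemma inv_into_id [simp]: "x \<in> X \<Longrightarrow> inv_into X id x = x"
  by (rule inv_into_f_eq) auto

lemma riemann_surface_planar:
  assumes "open X" "connected X" "X \<noteq> {}"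
  shows "riemann_surface (planar X)"
proof -
  have "complex_chart (top_of_set X) X id"
    using assms(1) by (simp add: complex_chart_def homeomorphic_map_id subtopology_subtopology)
  moreover have "(id \<circ> inv_into X id) holomorphic_on X"
    by (rule holomorphic_transform[OF holomorphic_on_ident]) simp
  moreover have "Hausdorff_space (top_of_set X)"
    by (simp add: Hausdorff_space_subtopology Hausdorff_space_euclidean)
  moreover have "connected_space (top_of_set X)"
    using assms(2) connectedin_def[of euclidean X] by simp
  ultimately show ?thesis
    using assms(3) by (simp add: riemann_surface_def)
qed

lemma holomorphic_map_planar_iff:
  "holomorphic_map (planar X) sphere h \<longleftrightarrow>
     continuous_map (top_of_set X) sphere_top h \<and>
     (\<lambda>p. the (h p)) holomorphic_on {p \<in> X. h p \<noteq> None} \<and>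
     (\<lambda>p. sphere_inversion (h p)) holomorphic_on {p \<in> X. h p \<noteq> Some 0}"
proof -
  have 1: "h p \<in> range Some \<longleftrightarrow> h p \<noteq> None" for p
    by (cases "h p") auto
  have 2: "(g \<circ> h \<circ> inv_into X id) holomorphic_on {p \<in> X. Q p} \<longleftrightarrow> (\<lambda>p. g (h p)) holomorphic_on {p \<in> X. Q p}"
    for g Q
    by (rule holomorphic_cong) auto
  show ?thesis
    by (simp add: holomorphic_map_def sphere_def 1 2)
qed

lemma holomorphic_map_planar_Some:
  assumes "g holomorphic_on X"
  shows "holomorphic_map (planar X) sphere (\<lambda>p. Some (g p))"
proof -
  have "continuous_map (top_of_set X) sphere_top (Some \<circ> g)"
    using holomorphic_on_imp_continuous_on[OF assms]
    by (intro continuous_map_compose[OF _ continuous_map_Some]) simp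
  moreover have "(\<lambda>p. inverse (g p)) holomorphic_on {p \<in> X. g p \<noteq> 0}"
    using assms by (intro holomorphic_intros) (auto intro: holomorphic_on_subset)
  ultimately show ?thesis
    using assms by (simp add: holomorphic_map_planar_iff sphere_inversion_def o_def)
qed

lemma holomorphic_map_planar_const: "holomorphic_map (planar X) sphere (\<lambda>_. x)"
  by (cases x) (auto simp: holomorphic_map_planar_iff)

lemma holomorphic_map_planar_the:
  assumes "holomorphic_map (planar X) sphere h" "\<And>p. p \<in> X \<Longrightarrow> h p \<noteq> None"
  shows "(\<lambda>p. the (h p)) holomorphic_on X"
proof -
  have "{p \<in> X. h p \<noteq> None} = X"
    using assms(2) by auto
  then show ?thesis
    using assms(1) unfolding holomorphic_map_planar_iff by simp
qed

text \<open>The automorphism 1/z of the sphere, with 0 split off because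
  \<open>inverse 0 = 0\<close>. Plane motions fix infinity; conjugated by this map they fix 0 and
  may move infinity.\<close>

definition sphere_swap :: "riemann_sphere \<Rightarrow> riemann_sphere" where
  "sphere_swap x = (case x of None \<Rightarrow> Some 0 | Some z \<Rightarrow> if z = 0 then None else Some (inverse z))"

lemma sphere_swap_swap [simp]: "sphere_swap (sphere_swap x) = x"
  by (auto simp: sphere_swap_def split: option.splits)

lemma sphere_swap_eq_iff [simp]: "sphere_swap x = sphere_swap y \<longleftrightarrow> x = y"
  by (metis sphere_swap_swap)

text \<open>Glued from two pieces: away from 0 it is the chart at infinity followed by
  \<open>Some\<close>, on the finite points it is the inverse \<open>k\<close> of that
  chart.\<close>

lemma continuous_map_sphere_swap: "continuous_map sphere_top sphere_top sphere_swap"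
proof -
  have "homeomorphic_map (subtopology sphere_top (- {Some 0}))
      (top_of_set (sphere_inversion ` (- {Some 0}))) sphere_inversion"
    using complex_chart_sphere_inversion by (simp add: complex_chart_def)
  moreover have "z \<in> sphere_inversion ` (- {Some 0})" for z
    by (rule image_eqI[of _ _ "if z = 0 then None else Some (inverse z)"])
       (auto simp: sphere_inversion_def)
  then have surj: "sphere_inversion ` (- {Some 0}) = UNIV"
    by blast
  ultimately obtain k where
    k: "homeomorphic_maps (subtopology sphere_top (- {Some 0})) euclidean sphere_inversion k"
    by (auto simp: homeomorphic_map_maps)
  have topU: "topspace sphere_top = (UNIV :: riemann_sphere set)"
    using points_sphere by (simp add: sphere_def)
  have k_eq: "k z = sphere_swap (Some z)" for z
  proof -
    have "k \<in> UNIV \<rightarrow> - {Some 0}" "sphere_inversion (k z) = z"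
      using k by (auto simp: homeomorphic_maps_def continuous_map_in_subtopology)
    then have "k z \<noteq> Some 0" "sphere_inversion (k z) = z"
      by auto
    then show ?thesis
      by (auto simp: sphere_inversion_def sphere_swap_def split: option.splits)
  qed
  have fin: "sphere_swap x = (Some \<circ> sphere_inversion) x" if "x \<noteq> Some 0" for x
    using that by (auto simp: sphere_inversion_def sphere_swap_def split: option.splits)
  have swp: "sphere_swap x = (k \<circ> the) x" if "x \<in> range Some" for x
    using that k_eq by auto
  have c1: "continuous_map (subtopology sphere_top (- {Some 0})) sphere_top (Some \<circ> sphere_inversion)"
    using k by (intro continuous_map_compose[OF _ continuous_map_Some]) (auto simp: homeomorphic_maps_def)
  have "continuous_map (subtopology sphere_top (range Some)) euclidean (the :: riemann_sphere \<Rightarrow> complex)"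
    using homeomorphic_imp_continuous_map[of _ _ the] complex_chart_sphere_the
    by (force simp: complex_chart_def image_image)
  moreover have "continuous_map euclidean sphere_top k"
    using k by (auto simp: homeomorphic_maps_def continuous_map_in_subtopology)
  ultimately have c2: "continuous_map (subtopology sphere_top (range Some)) sphere_top (k \<circ> the)"
    by (rule continuous_map_compose)
  show ?thesis
  proof (rule pasting_lemma[where I = UNIV and T = "\<lambda>b. if b then - {Some 0} else range Some"
        and f = "\<lambda>b. if b then Some \<circ> sphere_inversion else k \<circ> the"])
    show "openin sphere_top (if b then - {Some 0} else range Some)" for b
      using complex_chart_sphere_inversion complex_chart_sphere_the by (simp add: complex_chart_def)
    show "continuous_map (subtopology sphere_top (if b then - {Some 0} else range Some)) sphere_top
        (if b then Some \<circ> sphere_inversion else k \<circ> the)" for b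
      using c1 c2 by simp
    show "(if i then Some \<circ> sphere_inversion else k \<circ> the) x = (if j then Some \<circ> sphere_inversion else k \<circ> the) x"
      if "x \<in> topspace sphere_top \<inter> (if i then - {Some 0} else range Some) \<inter> (if j then - {Some 0} else range Some)"
      for i j x
      using that fin[of x] swp[of x] by (auto split: if_splits)
    show "\<exists>j. j \<in> UNIV \<and> x \<in> (if j then - {Some 0} else range Some) \<and>
        sphere_swap x = (if j then Some \<circ> sphere_inversion else k \<circ> the) x"
      if "x \<in> topspace sphere_top" for x
    proof (cases "x = Some 0")
      case True
      then show ?thesis
        using swp[of x] by (intro exI[of _ False]) auto
    next
      case False
      then show ?thesis
        using fin[of x] by (intro exI[of _ True]) auto
    qed
  qed
qed

text \<open>The inversion interchanges the two charts, hence also the two holomorphy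
  conditions.\<close>

lemma holomorphic_map_planar_swap:
  assumes "holomorphic_map (planar X) sphere h"
  shows "holomorphic_map (planar X) sphere (\<lambda>p. sphere_swap (h p))"
proof -
  have 1: "{p \<in> X. sphere_swap (h p) \<noteq> None} = {p \<in> X. h p \<noteq> Some 0}"
    by (auto simp: sphere_swap_def split: option.splits)
  have 2: "{p \<in> X. sphere_swap (h p) \<noteq> Some 0} = {p \<in> X. h p \<noteq> None}"
    by (auto simp: sphere_swap_def split: option.splits)
  have h: "continuous_map (top_of_set X) sphere_top h"
    "(\<lambda>p. the (h p)) holomorphic_on {p \<in> X. h p \<noteq> None}"
    "(\<lambda>p. sphere_inversion (h p)) holomorphic_on {p \<in> X. h p \<noteq> Some 0}"
    using assms by (auto simp: holomorphic_map_planar_iff)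
  show ?thesis
    unfolding holomorphic_map_planar_iff 1 2
  proof (intro conjI)
    show "continuous_map (top_of_set X) sphere_top (\<lambda>p. sphere_swap (h p))"
      using continuous_map_compose[OF h(1) continuous_map_sphere_swap] by (simp add: o_def)
    show "(\<lambda>p. the (sphere_swap (h p))) holomorphic_on {p \<in> X. h p \<noteq> Some 0}"
      by (rule holomorphic_transform[OF h(3)])
         (auto simp: sphere_swap_def sphere_inversion_def split: option.splits)
    show "(\<lambda>p. sphere_inversion (sphere_swap (h p))) holomorphic_on {p \<in> X. h p \<noteq> None}"
      by (rule holomorphic_transform[OF h(2)])
         (auto simp: sphere_swap_def sphere_inversion_def split: option.splits)
  qed
qed

lemma closed_curve_planarD:
  assumes "closed_curve (planar X) \<alpha>"
  shows "valid_path \<alpha>" "pathfinish \<alpha> = pathstart \<alpha>" "path_image \<alpha> \<subseteq> X"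
proof -
  have *: "pathin (top_of_set X) \<alpha>" "\<alpha> 0 = \<alpha> 1"
    "\<And>a b. 0 \<le> a \<Longrightarrow> a \<le> b \<Longrightarrow> b \<le> 1 \<Longrightarrow> \<alpha> ` {a..b} \<subseteq> X \<Longrightarrow> \<alpha> piecewise_C1_differentiable_on {a..b}"
    using assms by (auto simp: closed_curve_def)
  show X: "path_image \<alpha> \<subseteq> X"
    using *(1) by (auto simp: pathin_def continuous_map_in_subtopology path_image_def)
  show "valid_path \<alpha>"
    using *(3)[of 0 1] X by (auto simp: valid_path_def path_image_def)
  show "pathfinish \<alpha> = pathstart \<alpha>"
    using *(2) by (simp add: pathfinish_def pathstart_def)
qed

section \<open>The main theorem\<close>

lemma ann_neighbourhood:
  assumes "open U" "unit_circle \<subseteq> U"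
  obtains e where "0 < e" "e \<le> 1" "ann e \<subseteq> U"
proof -
  obtain d where d: "d > 0" "(\<Union>x\<in>unit_circle. ball x d) \<subseteq> U"
    using compact_subset_open_imp_ball_epsilon_subset[OF compact_sphere assms] by metis
  define e where "e = min d 1"
  have "ann e \<subseteq> U"
  proof
    fix p
    assume p: "p \<in> ann e"
    then have "p \<noteq> 0"
      using zero_notin_ann[of e] by (auto simp: e_def)
    then have "dist (sgn p) p < d"
      using dist_sgn[of p] p by (auto simp: ann_def e_def dist_commute)
    moreover have "sgn p \<in> unit_circle"
      using \<open>p \<noteq> 0\<close> by (simp add: norm_sgn)
    ultimately have "p \<in> (\<Union>x\<in>unit_circle. ball x d)"
      by (intro UN_I[of "sgn p"]) auto
    then show "p \<in> U"
      using d(2) by blast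
  qed
  then show ?thesis
    using that[of e] d(1) by (simp add: e_def)
qed

lemma ann_properties:
  assumes "0 < e"
  shows "connected (ann e)" "1 \<in> ann e"
proof -
  have "connected {x :: complex. 1 - e < norm (x - 0) \<and> norm (x - 0) < 1 + e}"
    by (rule connected_annulus) simp
  then show "connected (ann e)"
    by (simp add: ann_def)
  show "1 \<in> ann e"
    using assms by (simp add: ann_def)
qed

text \<open>Along the motion, \<open>f \<circ> \<alpha>\<close> is homotopic to loops traced out by points far away from \<open>b\<close>.\<close>

lemma plane_motion_winding_number_zero:
  assumes pm: "plane_motion e P \<zeta> f \<psi>" and b: "b \<in> P" "b \<noteq> \<zeta>"
    and \<alpha>: "path \<alpha>" "pathfinish \<alpha> = pathstart \<alpha>" "path_image \<alpha> \<subseteq> ann e"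
  shows "winding_number (f \<circ> \<alpha>) b = 0"
proof -
  have inj: "\<And>p. p \<in> ann e \<Longrightarrow> inj (\<psi> p)" and fixP: "\<And>p z. p \<in> ann e \<Longrightarrow> z \<in> P \<Longrightarrow> \<psi> p z = z"
    and track: "\<And>p. p \<in> ann e \<Longrightarrow> \<psi> p \<zeta> = f p"
    and cont: "continuous_on (ann e \<times> UNIV) (\<lambda>(p, z). \<psi> p z)"
    using pm unfolding plane_motion_def by blast+
  have "\<exists>C. \<forall>p\<in>ann e. \<forall>z. norm (\<psi> p z - z) \<le> C"
    using pm unfolding plane_motion_def by (elim conjE)
  then obtain C where C: "\<And>p z. p \<in> ann e \<Longrightarrow> norm (\<psi> p z - z) \<le> C"
    by blast
  have \<alpha>X: "\<alpha> t \<in> ann e" if "t \<in> {0..1}" for t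
    using \<alpha>(3) that by (auto simp: path_image_def)
  \<comment> \<open>Farther from \<open>b\<close> than the displacement bound, so the loop traced
    out by \<open>W\<close> stays in a disc that misses \<open>b\<close>.\<close>
  define W where "W = b + of_real (\<bar>C\<bar> + 1)"
  have "b - W = - of_real (\<bar>C\<bar> + 1)"
    by (simp add: W_def)
  then have "norm (b - W) = \<bar>\<bar>C\<bar> + 1\<bar>"
    by (simp only: norm_minus_cancel norm_of_real)
  then have W: "norm (b - W) > C" "W \<noteq> b"
    by auto
  have "path_connected (- {b})"
    by (rule path_connected_complement_countable) auto
  then obtain g where g: "path g" "path_image g \<subseteq> - {b}" "pathstart g = \<zeta>" "pathfinish g = W"
    using b(2) W(2) unfolding path_connected_def by (metis ComplI singletonD)
  define h where "h = (\<lambda>(s, t). \<psi> (\<alpha> t) (g s))"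
  have "homotopic_loops (- {b}) (f \<circ> \<alpha>) (\<lambda>t. \<psi> (\<alpha> t) W)"
    unfolding homotopic_loops
  proof (intro exI[of _ h] conjI ballI)
    have "continuous_on ({0..1} \<times> {0..1}) (\<lambda>x. \<alpha> (snd x))"
      by (rule continuous_on_compose2[OF \<alpha>(1)[unfolded path_def] continuous_on_snd]) auto
    moreover have "continuous_on ({0..1} \<times> {0..1}) (\<lambda>x. g (fst x))"
      by (rule continuous_on_compose2[OF g(1)[unfolded path_def] continuous_on_fst]) auto
    ultimately have "continuous_on ({0..1} \<times> {0..1}) (\<lambda>x. (\<alpha> (snd x), g (fst x)))"
      by (rule continuous_on_Pair)
    then have "continuous_on ({0..1} \<times> {0..1}) (\<lambda>x. (\<lambda>(p, z). \<psi> p z) (\<alpha> (snd x), g (fst x)))"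
      by (rule continuous_on_compose2[OF cont]) (use \<alpha>X in auto)
    then show "continuous_on ({0..1} \<times> {0..1}) h"
      by (simp add: h_def case_prod_unfold)
    show "h \<in> {0..1} \<times> {0..1} \<rightarrow> - {b}"
    proof
      fix x
      assume "x \<in> {0..1 :: real} \<times> {0..1 :: real}"
      then obtain s t where st: "x = (s, t)" "s \<in> {0..1}" "t \<in> {0..1}"
        by auto
      have "\<psi> (\<alpha> t) (g s) \<noteq> b"
      proof
        assume "\<psi> (\<alpha> t) (g s) = b"
        then have "\<psi> (\<alpha> t) (g s) = \<psi> (\<alpha> t) b"
          using fixP[OF \<alpha>X[OF st(3)] b(1)] by simp
        then have "g s = b"
          by (rule injD[OF inj[OF \<alpha>X[OF st(3)]]])
        then show False
          using g(2) st(2) by (auto simp: path_image_def)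
      qed
      then show "h x \<in> - {b}"
        by (simp add: h_def st(1))
    qed
  next
    fix x :: real
    assume x: "x \<in> {0..1}"
    show "h (0, x) = (f \<circ> \<alpha>) x" "h (1, x) = \<psi> (\<alpha> x) W"
      using g(3,4) track[OF \<alpha>X[OF x]] by (auto simp: h_def pathstart_def pathfinish_def)
    show "pathfinish (h \<circ> Pair x) = pathstart (h \<circ> Pair x)"
      using \<alpha>(2) by (simp add: h_def pathstart_def pathfinish_def)
  qed
  then have "winding_number (f \<circ> \<alpha>) b = winding_number (\<lambda>t. \<psi> (\<alpha> t) W) b"
    "path (\<lambda>t. \<psi> (\<alpha> t) W)"
    using winding_number_homotopic_loops homotopic_loops_imp_path by blast+
  moreover have "winding_number (\<lambda>t. \<psi> (\<alpha> t) W) b = 0"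
  proof (rule winding_number_zero_outside[OF calculation(2) convex_cball])
    show "pathfinish (\<lambda>t. \<psi> (\<alpha> t) W) = pathstart (\<lambda>t. \<psi> (\<alpha> t) W)"
      using \<alpha>(2) by (simp add: pathstart_def pathfinish_def)
    show "b \<notin> cball W C"
      using W(1) by (simp add: dist_norm norm_minus_commute)
    show "path_image (\<lambda>t. \<psi> (\<alpha> t) W) \<subseteq> cball W C"
      using C[OF \<alpha>X, of _ W] by (auto simp: path_image_def dist_norm norm_minus_commute)
  qed
  ultimately show ?thesis
    by simp
qed

section \<open>From motions of the plane to motions of the sphere\<close>

lemma holomorphic_motion_of_plane_motion:
  assumes "plane_motion e P \<zeta> f \<psi>" "0 < e"
  shows "holomorphic_motion (planar (ann e)) 1 UNIV (\<lambda>p. map_option (\<psi> p))"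
  unfolding holomorphic_motion_def
proof (intro conjI ballI)
  show "1 \<in> points (planar (ann e))"
    using ann_properties(2)[OF assms(2)] by simp
  show "map_option (\<psi> 1) z = z" for z
    using assms(1) by (cases z) (auto simp: plane_motion_def)
  show "inj (map_option (\<psi> p))" if "p \<in> points (planar (ann e))" for p
    using assms(1) that by (intro option.inj_map) (auto simp: plane_motion_def)
  show "holomorphic_map (planar (ann e)) sphere (\<lambda>p. map_option (\<psi> p) z)" for z
    using assms(1) by (cases z)
      (auto simp: plane_motion_def intro: holomorphic_map_planar_const holomorphic_map_planar_Some)
qed

lemma holomorphic_motion_swap:
  assumes "holomorphic_motion (planar X) p\<^sub>0 UNIV \<Psi>"
  shows "holomorphic_motion (planar X) p\<^sub>0 UNIV (\<lambda>p z. sphere_swap (\<Psi> p (sphere_swap z)))"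
  unfolding holomorphic_motion_def
proof (intro conjI ballI)
  show "p\<^sub>0 \<in> points (planar X)" and "sphere_swap (\<Psi> p\<^sub>0 (sphere_swap z)) = z" for z
    using assms by (simp_all add: holomorphic_motion_def)
  show "inj (\<lambda>z. sphere_swap (\<Psi> p (sphere_swap z)))" if "p \<in> points (planar X)" for p
  proof (rule injI)
    fix z w
    assume "sphere_swap (\<Psi> p (sphere_swap z)) = sphere_swap (\<Psi> p (sphere_swap w))"
    then have "\<Psi> p (sphere_swap z) = \<Psi> p (sphere_swap w)"
      by simp
    moreover have "inj (\<Psi> p)"
      using assms that by (simp add: holomorphic_motion_def)
    ultimately have "sphere_swap z = sphere_swap w"
      by (rule injD[rotated])
    then show "z = w"
      by simp
  qed
  show "holomorphic_map (planar X) sphere (\<lambda>p. sphere_swap (\<Psi> p (sphere_swap z)))" for z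
    using assms by (intro holomorphic_map_planar_swap) (simp add: holomorphic_motion_def)
qed

lemma wandering_point_motion:
  fixes A :: "complex set"
  assumes A: "finite A" "0 \<in> A" "1 \<in> A" "\<zeta> \<notin> A"
    and E: "E = insert None (insert (Some \<zeta>) (Some ` A))"
  obtains X :: "complex surface" and p\<^sub>0 \<phi> where
    "riemann_surface X" "holomorphic_motion X p\<^sub>0 E \<phi>" "normalized_motion X E \<phi>"
    "\<And>\<alpha> w w'. closed_curve X \<alpha> \<Longrightarrow> w \<in> E - {None} \<Longrightarrow> w' \<in> E - {None} \<Longrightarrow> w \<noteq> w' \<Longrightarrow>
       arg_variation \<phi> \<alpha> w w' = 0"
    "\<And>E'. E' \<subset> E \<Longrightarrow> extends_to_sphere X p\<^sub>0 E' \<phi>"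
    "\<not> extends_to_sphere X p\<^sub>0 E \<phi>"
proof -
  obtain x where x: "path x" "pathstart x = \<zeta>" "pathfinish x = \<zeta>" "path_image x \<subseteq> - A"
    "\<not> null_loop (- A) x" "\<And>d. d \<in> A \<Longrightarrow> null_loop (- (A - {d})) x"
    "null_loop (- (inverse ` (A - {0}))) (inverse \<circ> x)"
    by (rule brunnian_loop[OF A]) (rule that)
  obtain c where c: "continuous_on unit_circle c" "\<And>t. t \<in> {0..1} \<Longrightarrow> c (circlepath 0 1 t) = x t"
    using circle_function_of_loop[OF x(1)] x(2,3) by metis
  obtain d where d: "d > 0" "\<And>u a. u \<in> path_image x \<Longrightarrow> a \<in> A \<Longrightarrow> d \<le> dist u a"
    using separate_compact_closed[OF compact_path_image[OF x(1)] finite_imp_closed[OF A(1)]] x(4)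
    by (metis disjoint_eq_subset_Compl)
  obtain f where f: "f holomorphic_on - {0}" "f 1 = c 1" "\<And>z. z \<in> unit_circle \<Longrightarrow> norm (f z - c z) < d"
    using holomorphic_approximation_on_circle[OF c(1) d(1)] by metis
  have circ: "circlepath 0 1 t \<in> unit_circle" for t
    by (simp add: circlepath norm_mult)
  have f1: "f 1 = \<zeta>"
    using f(2) c(2)[of 0] x(2) by (simp add: circlepath pathstart_def)
  let ?\<gamma> = "f \<circ> circlepath 0 1"
  \<comment> \<open>The holomorphic loop is closer to \<open>x\<close> than \<open>x\<close> is to
    \<open>A\<close>, so the straight-line homotopy between them avoids \<open>A\<close>.\<close>
  have near: "norm (?\<gamma> t - x t) < norm (x t - a)" if "t \<in> {0..1}" "a \<in> A" for t a
  proof -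
    have "norm (?\<gamma> t - x t) < d"
      using f(3)[OF circ] c(2)[OF that(1)] by (metis comp_apply)
    also have "d \<le> norm (x t - a)"
      using d(2)[of "x t" a] that by (auto simp: path_image_def dist_norm)
    finally show ?thesis .
  qed
  have \<gamma>: "path ?\<gamma>" "pathfinish ?\<gamma> = pathstart ?\<gamma>"
  proof -
    have "continuous_on unit_circle f"
      by (rule holomorphic_on_imp_continuous_on[OF holomorphic_on_subset[OF f(1)]]) auto
    then show "path ?\<gamma>"
      by (intro path_continuous_image) auto
  qed (simp add: pathfinish_compose pathstart_compose)
  have hom: "homotopic_loops (- A) x ?\<gamma>"
    using x(1-3) \<gamma> near by (intro homotopic_loops_nearby_explicit) auto
  have hom_inv: "homotopic_loops (- (inverse ` (A - {0}))) (inverse \<circ> x) (inverse \<circ> ?\<gamma>)"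
    by (rule homotopic_loops_continuous_image[OF hom])
       (use A(2) in \<open>auto intro!: continuous_intros\<close>)
  have null: "null_loop (- (A - {a})) ?\<gamma>" if "a \<in> A" for a
    using null_loop_homotopic[OF x(6)[OF that] homotopic_loops_subset[OF hom]] by auto
  have null_inv: "null_loop (- (inverse ` (A - {0}))) ((\<lambda>p. inverse (f p)) \<circ> circlepath 0 1)"
    using null_loop_homotopic[OF x(7) hom_inv] by (simp add: o_def)
  have not_null: "\<not> null_loop (- A) ?\<gamma>"
    using null_loop_homotopic[OF _ homotopic_loops_sym[OF hom]] x(5) by blast
  have fS: "f p \<notin> A" if "p \<in> unit_circle" for p
  proof -
    have "p \<in> path_image (circlepath 0 1)"
      using that by simp
    then obtain t where "t \<in> {0..1}" "p = circlepath 0 1 t"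
      unfolding path_image_def by blast
    then have "f p \<in> path_image ?\<gamma>"
      by (auto simp: path_image_def)
    then show ?thesis
      using homotopic_loops_imp_subset[OF hom] by blast
  qed
  have "open (- {0} \<inter> f -` (- A))"
    using holomorphic_on_imp_continuous_on[OF f(1)] finite_imp_closed[OF A(1)]
    by (intro continuous_open_preimage) auto
  moreover have "unit_circle \<subseteq> - {0} \<inter> f -` (- A)"
    using fS by auto
  ultimately obtain e where e: "0 < e" "e \<le> 1" "ann e \<subseteq> - {0} \<inter> f -` (- A)"
    by (rule ann_neighbourhood) (rule that)
  have fA: "f p \<notin> A" if "p \<in> ann e" for p
    using e(3) that by auto
  have fhol: "f holomorphic_on ann e"
    using f(1) e(3) by (auto intro: holomorphic_on_subset)
  have "\<exists>e'>0. e' \<le> e \<and> (\<exists>\<psi>. plane_motion e' (A - {a}) \<zeta> f \<psi>)" if "a \<in> A" for a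
    by (rule motion_of_null_loop[OF finite_Diff[OF A(1)] e(1,2) fhol f1 null[OF that]]) blast
  then obtain r where r: "\<And>a. a \<in> A \<Longrightarrow> r a > 0" "\<And>a. a \<in> A \<Longrightarrow> r a \<le> e"
    "\<And>a. a \<in> A \<Longrightarrow> \<exists>\<psi>. plane_motion (r a) (A - {a}) \<zeta> f \<psi>"
    by metis
  have "(\<lambda>p. inverse (f p)) holomorphic_on ann e"
    using fhol
  proof (intro holomorphic_intros)
    show "f p \<noteq> 0" if "p \<in> ann e" for p
      using fA[OF that] A(2) by metis
  qed
  then obtain r' \<psi>' where r': "r' > 0" "r' \<le> e"
    "plane_motion r' (inverse ` (A - {0})) (inverse \<zeta>) (\<lambda>p. inverse (f p)) \<psi>'"
    by (rule motion_of_null_loop[OF finite_imageI[OF finite_Diff[OF A(1)]] e(1,2) _ _ null_inv, of "inverse \<zeta>"])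
       (simp add: f1, rule that)
  \<comment> \<open>Each filled puncture, and infinity, came with an annulus of its own; finitely
    many have a common one.\<close>
  define \<rho> where "\<rho> = Min (insert r' (r ` A))"
  have \<rho>: "\<rho> > 0" "\<rho> \<le> r'" "\<And>a. a \<in> A \<Longrightarrow> \<rho> \<le> r a"
    using A(1) r(1) r'(1) by (auto simp: \<rho>_def)
  have \<rho>e: "\<rho> \<le> e"
    using \<rho>(3) r(2) A(2) order_trans by blast
  then have sub: "ann \<rho> \<subseteq> ann e" and \<rho>1: "\<rho> \<le> 1"
    using ann_mono e(2) by auto
  have pm: "\<exists>\<psi>. plane_motion \<rho> (A - {a}) \<zeta> f \<psi>" if "a \<in> A" for a
    using r(3)[OF that] plane_motion_mono[OF _ \<rho>(3)[OF that]] by blast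
  have pm': "plane_motion \<rho> (inverse ` (A - {0})) (inverse \<zeta>) (\<lambda>p. inverse (f p)) \<psi>'"
    using plane_motion_mono[OF r'(3) \<rho>(2)] .
  define X where "X = planar (ann \<rho>)"
  define \<phi> where "\<phi> = (\<lambda>p z. if z = Some \<zeta> then Some (f p) else z)"
  have pts: "points X = ann \<rho>"
    by (simp add: X_def)
  have one: "1 \<in> ann \<rho>"
    using ann_properties(2)[OF \<rho>(1)] .
  have fA': "f p \<notin> A" if "p \<in> ann \<rho>" for p
    using fA sub that by auto
  have surface: "riemann_surface X"
    unfolding X_def using ann_properties[OF \<rho>(1)] by (intro riemann_surface_planar) auto
  have motion: "holomorphic_motion X 1 E \<phi>"
    unfolding holomorphic_motion_def
  proof (intro conjI ballI)
    show "\<phi> 1 z = z" for z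
      by (simp add: \<phi>_def f1)
    show "inj_on (\<phi> p) E" if "p \<in> points X" for p
      using fA'[of p] that A(4) unfolding pts by (auto simp: inj_on_def \<phi>_def E)
    show "holomorphic_map X sphere (\<lambda>p. \<phi> p z)" for z
      unfolding X_def \<phi>_def using holomorphic_on_subset[OF fhol sub]
      by (cases "z = Some \<zeta>") (auto intro: holomorphic_map_planar_const holomorphic_map_planar_Some)
  qed (use one pts in auto)
  have normalized: "normalized_motion X E \<phi>"
    unfolding normalized_motion_def using A by (auto simp: E \<phi>_def)
  have wn0: "winding_number (f \<circ> \<alpha>) b = 0"
    if \<alpha>: "path \<alpha>" "pathfinish \<alpha> = pathstart \<alpha>" "path_image \<alpha> \<subseteq> ann \<rho>" and b: "b \<in> A" for \<alpha> b
  proof -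
    \<comment> \<open>Filling in a second puncture \<open>a\<close> gives a plane motion that still
      fixes \<open>b\<close>, which rules out winding around \<open>b\<close>.\<close>
    obtain a where a: "a \<in> A" "a \<noteq> b"
      using A(2,3) by (metis zero_neq_one)
    obtain \<psi> where "plane_motion \<rho> (A - {a}) \<zeta> f \<psi>"
      using pm[OF a(1)] by blast
    then show ?thesis
      by (rule plane_motion_winding_number_zero) (use \<alpha> a b A(4) in auto)
  qed
  have variation: "arg_variation \<phi> \<alpha> w w' = 0"
    if curve: "closed_curve X \<alpha>" and w: "w \<in> E - {None}" "w' \<in> E - {None}" "w \<noteq> w'" for \<alpha> w w'
  proof -
    note \<alpha> = closed_curve_planarD[OF curve[unfolded X_def]]
    have \<alpha>t: "\<alpha> t \<in> ann \<rho>" if "t \<in> {0..1}" for t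
      using \<alpha>(3) that by (auto simp: path_image_def)
    have vp: "valid_path (f \<circ> \<alpha>)"
      by (rule valid_path_compose_holomorphic[OF \<alpha>(1) fhol ann_open]) (use \<alpha>(3) sub in auto)
    have int: "contour_integral (\<lambda>t. f (\<alpha> t) - b) (\<lambda>w. 1 / w) = 0"
      "contour_integral (\<lambda>t. b - f (\<alpha> t)) (\<lambda>w. 1 / w) = 0" if b: "b \<in> A" for b
    proof -
      have nb: "0 \<notin> path_image (\<lambda>t. f (\<alpha> t) - b)" "0 \<notin> path_image (\<lambda>t. b - f (\<alpha> t))"
        using fA'[OF \<alpha>t] b by (auto simp: path_image_def)
      have v1: "valid_path (\<lambda>t. f (\<alpha> t) - b)"
        using valid_path_compose_holomorphic[OF vp, of "\<lambda>z. z - b" UNIV]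
        by (simp add: o_def holomorphic_intros)
      have v2: "valid_path (\<lambda>t. b - f (\<alpha> t))"
        using valid_path_compose_holomorphic[OF vp, of "\<lambda>z. b - z" UNIV]
        by (simp add: o_def holomorphic_intros)
      have 0: "winding_number (f \<circ> \<alpha>) b = 0"
        using \<alpha> by (intro wn0[OF _ _ _ b]) (auto intro: valid_path_imp_path)
      have w1: "winding_number (\<lambda>t. f (\<alpha> t) - b) 0 = 0"
        using 0 winding_number_offset[of "f \<circ> \<alpha>" b] by (simp add: o_def)
      have w2: "winding_number (\<lambda>t. b - f (\<alpha> t)) 0 = 0"
        using winding_number_negatepath[OF v1 nb(1)] w1 by (simp add: o_def)
      show "contour_integral (\<lambda>t. f (\<alpha> t) - b) (\<lambda>w. 1 / w) = 0"
        using winding_number_valid_path[OF v1 nb(1)] w1 by simp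
      show "contour_integral (\<lambda>t. b - f (\<alpha> t)) (\<lambda>w. 1 / w) = 0"
        using winding_number_valid_path[OF v2 nb(2)] w2 by simp
    qed
    consider b where "b \<in> A" "w = Some \<zeta>" "w' = Some b" | b where "b \<in> A" "w = Some b" "w' = Some \<zeta>"
      | b b' where "b \<in> A" "b' \<in> A" "w = Some b" "w' = Some b'"
      using w by (auto simp: E)
    then show ?thesis
    proof cases
      case 1
      then have "b \<noteq> \<zeta>"
        using A(4) by auto
      then show ?thesis
        using int(1)[OF 1(1)] 1(2,3) by (simp add: arg_variation_def \<phi>_def)
    next
      case 2
      then have "b \<noteq> \<zeta>"
        using A(4) by auto
      then show ?thesis
        using int(2)[OF 2(1)] 2(2,3) by (simp add: arg_variation_def \<phi>_def)
    next
      case 3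
      then have "b \<noteq> \<zeta>" "b' \<noteq> \<zeta>"
        using A(4) by auto
      then show ?thesis
        using 3 contour_integral_trivial[of "b - b'" "\<lambda>w. 1 / w"]
        by (simp add: arg_variation_def \<phi>_def linepath_refl_const)
    qed
  qed
  have ext: "extends_to_sphere X 1 E' \<phi>" if E': "E' \<subset> E" for E'
  proof -
    \<comment> \<open>The omitted point decides: without \<open>\<zeta>\<close> nothing moves,
      without a puncture \<open>a\<close> the motion with \<open>a\<close> filled in serves, and
      without infinity the one built in the coordinate 1/z.\<close>
    obtain v where v: "v \<in> E" "v \<notin> E'"
      using E' by blast
    consider "v = Some \<zeta>" | a where "a \<in> A" "v = Some a" | "v = None"
      using v(1) by (auto simp: E)
    then show ?thesis
    proof cases
      case 1
      have "holomorphic_motion X 1 UNIV (\<lambda>_ z. z)"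
        unfolding holomorphic_motion_def using one
        by (auto simp: X_def intro: holomorphic_map_planar_const)
      moreover have "\<phi> p z = z" if "z \<in> E'" for p z
        using that v(2) 1 by (auto simp: \<phi>_def)
      ultimately show ?thesis
        unfolding extends_to_sphere_def by (intro exI[of _ "\<lambda>_ z. z"]) auto
    next
      case 2
      obtain \<psi> where \<psi>: "plane_motion \<rho> (A - {a}) \<zeta> f \<psi>"
        using pm[OF 2(1)] by blast
      have "map_option (\<psi> p) z = \<phi> p z" if "p \<in> ann \<rho>" "z \<in> E'" for p z
      proof -
        have "z \<in> insert None (insert (Some \<zeta>) (Some ` (A - {a})))"
          using that(2) E' v(2) 2 by (auto simp: E)
        then show ?thesis
          using \<psi> that(1) A(4) by (auto simp: plane_motion_def \<phi>_def)
      qed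
      then show ?thesis
        using holomorphic_motion_of_plane_motion[OF \<psi> \<rho>(1)] unfolding extends_to_sphere_def pts
        by (auto simp: X_def)
    next
      case 3
      \<comment> \<open>The point 0 is fixed because it becomes infinity, which
        \<open>map_option\<close> leaves alone; the other punctures and \<open>\<zeta>\<close> are
        carried through their inverses.\<close>
      have "sphere_swap (map_option (\<psi>' p) (sphere_swap z)) = \<phi> p z" if p: "p \<in> ann \<rho>" and z: "z \<in> E'" for p z
      proof -
        have "f p \<noteq> 0" "\<zeta> \<noteq> 0"
          using fA'[OF p] A by auto
        moreover have "z = Some \<zeta> \<or> z = Some 0 \<or> (\<exists>b\<in>A - {0}. z = Some b)"
          using z E' v(2) 3 by (auto simp: E)
        moreover have "\<psi>' p (inverse \<zeta>) = inverse (f p)" "\<And>b. b \<in> A - {0} \<Longrightarrow> \<psi>' p (inverse b) = inverse b"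
          using pm' p by (auto simp: plane_motion_def)
        ultimately show ?thesis
          using A(4) by (auto simp: sphere_swap_def \<phi>_def split: if_splits)
      qed
      then show ?thesis
        using holomorphic_motion_swap[OF holomorphic_motion_of_plane_motion[OF pm' \<rho>(1)]]
        unfolding extends_to_sphere_def pts by (auto simp: X_def)
    qed
  qed
  have not_ext: "\<not> extends_to_sphere X 1 E \<phi>"
  proof
    assume "extends_to_sphere X 1 E \<phi>"
    then obtain \<Psi> where \<Psi>: "holomorphic_motion X 1 UNIV \<Psi>" "\<And>p z. p \<in> ann \<rho> \<Longrightarrow> z \<in> E \<Longrightarrow> \<Psi> p z = \<phi> p z"
      unfolding extends_to_sphere_def pts by blast
    have inj: "inj (\<Psi> p)" if "p \<in> ann \<rho>" for p
      using \<Psi>(1) that unfolding holomorphic_motion_def pts by blast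
    \<comment> \<open>The extension fixes infinity, which belongs to \<open>E\<close>, so by
      injectivity finite points stay finite and plane-valued functions \<open>g w\<close> are
      available.\<close>
    have fin: "\<Psi> p (Some w) \<noteq> None" if "p \<in> ann \<rho>" for p w
    proof -
      have "\<Psi> p None = None"
        using \<Psi>(2)[OF that, of None] by (simp add: E \<phi>_def)
      then show ?thesis
        using injD[OF inj[OF that], of "Some w" None] by auto
    qed
    define g where "g = (\<lambda>w p. the (\<Psi> p (Some w)))"
    have g: "\<Psi> p (Some w) = Some (g w p)" if "p \<in> ann \<rho>" for p w
      using fin[OF that, of w] by (simp add: g_def)
    have g\<zeta>: "g \<zeta> p = f p" if "p \<in> ann \<rho>" for p
      using \<Psi>(2)[OF that, of "Some \<zeta>"] by (simp add: g_def E \<phi>_def)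
    have g\<gamma>: "g \<zeta> \<circ> circlepath 0 1 = ?\<gamma>"
      using g\<zeta>[OF subsetD[OF sphere_subset_ann[OF \<rho>(1)] circ]] by (auto simp: fun_eq_iff)
    have "null_loop (- A) (g \<zeta> \<circ> circlepath 0 1)"
    proof (rule null_loop_of_motion[OF \<rho>(1) \<rho>1 A])
      show "g w holomorphic_on ann \<rho>" for w
        unfolding g_def using \<Psi>(1) fin
        by (intro holomorphic_map_planar_the) (auto simp: holomorphic_motion_def X_def)
      show "g w 1 = w" for w
        using \<Psi>(1) by (simp add: g_def holomorphic_motion_def)
      show "g w p \<noteq> g w' p" if "w \<noteq> w'" "p \<in> ann \<rho>" for w w' p
        using injD[OF inj[OF that(2)], of "Some w" "Some w'"] that g by auto
      show "g a p = a" if "a \<in> A" "p \<in> ann \<rho>" for a p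
        using \<Psi>(2)[OF that(2), of "Some a"] that(1) A(4) by (auto simp: g_def E \<phi>_def)
      show "winding_number (g \<zeta> \<circ> circlepath 0 1) 0 = 0"
        unfolding g\<gamma> by (rule null_loop_winding_number[OF null[OF A(3)]]) (use A(2) in auto)
    qed
    then show False
      using not_null unfolding g\<gamma> by blast
  qed
  show ?thesis
    by (rule that[OF surface motion normalized variation ext not_ext])
qed

theorem theorem2:
  fixes n :: nat and z :: "nat \<Rightarrow> riemann_sphere" and E :: "riemann_sphere set"
  assumes "E = {Some 0, Some 1, None} \<union> z ` {0..n}"
    and "card E = n + 4"
  shows "(\<exists>(X :: complex surface) p\<^sub>0 \<phi>.
            riemann_surface X \<and> holomorphic_motion X p\<^sub>0 E \<phi> \<and> normalized_motion X E \<phi> \<and>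
            (\<forall>\<alpha>. closed_curve X \<alpha> \<longrightarrow>
               (\<forall>w\<in>E - {None}. \<forall>w'\<in>E - {None}. w \<noteq> w' \<longrightarrow> arg_variation \<phi> \<alpha> w w' = 0)) \<and>
            \<not> extends_to_sphere X p\<^sub>0 E \<phi>)
       \<and> (\<exists>(X :: complex surface) p\<^sub>0 \<phi>.
            riemann_surface X \<and> holomorphic_motion X p\<^sub>0 E \<phi> \<and> normalized_motion X E \<phi> \<and>
            (\<forall>E'. E' \<subset> E \<longrightarrow> extends_to_sphere X p\<^sub>0 E' \<phi>) \<and>
            \<not> extends_to_sphere X p\<^sub>0 E \<phi>)"
proof -
  \<comment> \<open>The wandering point is \<open>z 0\<close>. Were it 0, 1 or infinity,
    \<open>E\<close> would have at most \<open>n + 3\<close> elements.\<close>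
  have "z 0 \<notin> {Some 0, Some 1, None}"
  proof
    assume z0: "z 0 \<in> {Some 0, Some 1, None}"
    have "{0..n} = insert 0 {1..n}"
      by auto
    then have "E = {Some 0, Some 1, None} \<union> z ` {1..n}"
      using assms(1) z0 by auto
    then have "card E \<le> card {Some (0 :: complex), Some 1, None} + card (z ` {1..n})"
      by (simp only: card_Un_le)
    also have "\<dots> \<le> 3 + n"
      using card_image_le[of "{1..n}" z] by (intro add_mono) (auto intro: card_insert_le_m1)
    finally show False
      using assms(2) by simp
  qed
  then obtain \<zeta> where \<zeta>: "z 0 = Some \<zeta>" "\<zeta> \<noteq> 0" "\<zeta> \<noteq> 1"
    by (cases "z 0") auto
  define A where "A = {a. Some a \<in> E} - {\<zeta>}"
  have "finite E"
    using assms(1) by simp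
  then have "finite (Some -` E)"
    by (rule finite_vimageI) simp
  then have A: "finite A" "0 \<in> A" "1 \<in> A" "\<zeta> \<notin> A"
    using assms(1) \<zeta> by (auto simp: A_def vimage_def)
  have "Some \<zeta> \<in> E"
    using assms(1) \<zeta>(1) by (force simp: image_iff)
  then have "E = insert None (insert (Some \<zeta>) (Some ` A))"
    using assms(1) by (auto simp: A_def image_iff)
  then obtain X :: "complex surface" and p\<^sub>0 \<phi> where
    X: "riemann_surface X" "holomorphic_motion X p\<^sub>0 E \<phi>" "normalized_motion X E \<phi>"
    "\<And>\<alpha> w w'. closed_curve X \<alpha> \<Longrightarrow> w \<in> E - {None} \<Longrightarrow> w' \<in> E - {None} \<Longrightarrow> w \<noteq> w' \<Longrightarrow>
       arg_variation \<phi> \<alpha> w w' = 0"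
    "\<And>E'. E' \<subset> E \<Longrightarrow> extends_to_sphere X p\<^sub>0 E' \<phi>"
    "\<not> extends_to_sphere X p\<^sub>0 E \<phi>"
    by (rule wandering_point_motion[OF A]) (rule that)
  show ?thesis
  proof
    show "\<exists>(X :: complex surface) p\<^sub>0 \<phi>.
        riemann_surface X \<and> holomorphic_motion X p\<^sub>0 E \<phi> \<and> normalized_motion X E \<phi> \<and>
        (\<forall>\<alpha>. closed_curve X \<alpha> \<longrightarrow>
           (\<forall>w\<in>E - {None}. \<forall>w'\<in>E - {None}. w \<noteq> w' \<longrightarrow> arg_variation \<phi> \<alpha> w w' = 0)) \<and>
        \<not> extends_to_sphere X p\<^sub>0 E \<phi>"
      using X(1-4,6) by blast
    show "\<exists>(X :: complex surface) p\<^sub>0 \<phi>.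
        riemann_surface X \<and> holomorphic_motion X p\<^sub>0 E \<phi> \<and> normalized_motion X E \<phi> \<and>
        (\<forall>E'. E' \<subset> E \<longrightarrow> extends_to_sphere X p\<^sub>0 E' \<phi>) \<and>
        \<not> extends_to_sphere X p\<^sub>0 E \<phi>"
      using X(1-3,5,6) by blast
  qed
qed

end
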